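(* There is a positive constant $c_1$ such that for every positive integer $\delta$, all sufficiently large $n$, and all sufficiently large $K$ (depending on $n$ and $\delta$): if $X_1,\ldots,X_n$ is an arrangement of $n$ pebbles on the $K\times K$ grid in the unit square satisfying \[ C(X_1,\ldots,X_n \mid n,K) \ \ge\ \log \binom{K^2}{n} - \delta, \] then every triangle whose vertices are three of the pebbles has area at least $c_1/(2^{\delta} n^3)$.
   Context: The $K\times K$ grid in the unit square $[0,1]^2$ is the set of points $(i/(K-1), j/(K-1))$ with $i,j\in\{0,\ldots,K-1\}$. An arrangement of $n$ pebbles is a set of $n$ distinct grid points (unlabeled, at most one per grid point), encoded as a binary string in a fixed natural way. $C(x\mid y)$ denotes the conditional (plain) Kolmogorov complexity of $x$ given $y$ with respect to a fixed reference universal Turing machine. $\log$ is the binary logarithm. *)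

theory Defs
  imports "HOL-Analysis.Analysis"
begin

text \<open>
  Deterministic multi-tape Turing machines with two-way infinite tapes over the tape alphabet
  \<open>{0, 1, blank}\<close>. A tape symbol is a \<^typ>\<open>bool option\<close>, \<open>None\<close> being the blank.
\<close>

datatype head_move = Move_Left | Move_None | Move_Right

text \<open>
  The states are \<open>0, \<dots>, tm_states M - 1\<close>, with initial state \<open>0\<close>. Given the state and the list of the
  scanned symbols (one per tape), the transition function yields the new state and, for each tape,
  the symbol to be written and the head move; \<open>None\<close> means that the machine halts. Only its
  values at proper states and at lists of length \<open>tm_tapes M\<close> matter, so it is a finite table.
\<close>

record tm =
  tm_states :: nat
  tm_tapes :: nat
  tm_delta :: "nat \<Rightarrow> bool option list \<Rightarrow> (nat \<times> (bool option \<times> head_move) list) option"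

text \<open>Tapes 0, 1 and 2 hold the program, the conditional information and the output.\<close>

definition turing_machine :: "tm \<Rightarrow> bool" where
  "turing_machine M \<longleftrightarrow> 0 < tm_states M \<and> 3 \<le> tm_tapes M \<and>
     (\<forall>q s q' as. q < tm_states M \<and> length s = tm_tapes M \<and> tm_delta M q s = Some (q', as)
        \<longrightarrow> q' < tm_states M \<and> length as = tm_tapes M)"

text \<open>A tape is a pair of head position and contents.\<close>

type_synonym tape = "int \<times> (int \<Rightarrow> bool option)"
type_synonym tm_config = "nat \<times> tape list"

fun tape_read :: "tape \<Rightarrow> bool option" where
  "tape_read (h, f) = f h"

fun move_head :: "head_move \<Rightarrow> int \<Rightarrow> int" where
  "move_head Move_Left h = h - 1"
| "move_head Move_None h = h"
| "move_head Move_Right h = h + 1"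

fun tape_act :: "bool option \<times> head_move \<Rightarrow> tape \<Rightarrow> tape" where
  "tape_act (a, m) (h, f) = (move_head m h, f(h := a))"

fun tm_step :: "tm \<Rightarrow> tm_config \<Rightarrow> tm_config option" where
  "tm_step M (q, ts) =
     (case tm_delta M q (map tape_read ts) of
        None \<Rightarrow> None
      | Some (q', as) \<Rightarrow> Some (q', map2 tape_act as ts))"

definition string_contents :: "bool list \<Rightarrow> int \<Rightarrow> bool option" where
  "string_contents x z = (if 0 \<le> z \<and> z < int (length x) then Some (x ! nat z) else None)"

definition tm_init :: "tm \<Rightarrow> bool list \<Rightarrow> bool list \<Rightarrow> tm_config" where
  "tm_init M p y =
     (0, (0, string_contents p) # (0, string_contents y) #
         replicate (tm_tapes M - 2) (0, string_contents []))"

definition tm_outputs :: "tm \<Rightarrow> bool list \<Rightarrow> bool list \<Rightarrow> bool list \<Rightarrow> bool" where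
  "tm_outputs M p y x \<longleftrightarrow>
     (\<exists>q ts. (\<lambda>c d. tm_step M c = Some d)\<^sup>*\<^sup>* (tm_init M p y) (q, ts) \<and>
             tm_step M (q, ts) = None \<and> snd (ts ! 2) = string_contents x)"

text \<open>
  A universal machine simulates every machine \<open>T\<close> with programs that are longer by at most a
  constant depending on \<open>T\<close> only. This includes the usual universal machines, which simulate \<open>T\<close> on
  the program \<open>p\<close> when given \<open>p\<close> prefixed by a self-delimiting code of \<open>T\<close>.
\<close>

definition universal_tm :: "tm \<Rightarrow> bool" where
  "universal_tm U \<longleftrightarrow> turing_machine U \<and>
     (\<forall>T. turing_machine T \<longrightarrow>
        (\<exists>c. \<forall>p. \<exists>q. length q \<le> length p + c \<and>
           (\<forall>y x. tm_outputs U q y x \<longleftrightarrow> tm_outputs T p y x)))"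

text \<open>
  Plain conditional complexity of \<open>x\<close> given \<open>y\<close>. For universal \<open>U\<close> the set is nonempty, so the
  infimum is attained.
\<close>

definition kolmogorov :: "tm \<Rightarrow> bool list \<Rightarrow> bool list \<Rightarrow> nat" where
  "kolmogorov U x y = Inf {length p | p. tm_outputs U p y x}"

definition grid_point :: "nat \<Rightarrow> nat \<Rightarrow> nat \<Rightarrow> real ^ 2" where
  "grid_point K i j = vector [real i / (real K - 1), real j / (real K - 1)]"

definition grid :: "nat \<Rightarrow> (real ^ 2) set" where
  "grid K = {grid_point K i j | i j. i < K \<and> j < K}"

definition arrangement :: "nat \<Rightarrow> nat \<Rightarrow> (real ^ 2) set \<Rightarrow> bool" where
  "arrangement n K X \<longleftrightarrow> X \<subseteq> grid K \<and> card X = n"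

text \<open>
  An arrangement is encoded by its characteristic string of length \<open>K\<^sup>2\<close>, listing the grid points
  in lexicographic order of \<open>(i, j)\<close>; the pair \<open>(n, K)\<close> is encoded as \<open>1\<^sup>n 0 1\<^sup>K\<close>. Any other
  computable encodings change the complexity by at most an additive constant.
\<close>

definition encode_arrangement :: "nat \<Rightarrow> (real ^ 2) set \<Rightarrow> bool list" where
  "encode_arrangement K X = map (\<lambda>m. grid_point K (m div K) (m mod K) \<in> X) [0..<K * K]"

definition encode_pair :: "nat \<Rightarrow> nat \<Rightarrow> bool list" where
  "encode_pair n K = replicate n True @ [False] @ replicate K True"

end

theory Submission
  imports Defs
begin

text \<open>
  If an arrangement has a triangle of small area, it can be described by its index in an enumeration
  of all pairs of an arrangement and three of its pebbles, sorted by the area of the triangle they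
  span. The sorting makes the decoder independent of the area threshold, and hence of \<open>\<delta>\<close>.

  At most \<open>12 K\<^sup>4 (2a + K)\<close> triples of grid points span a triangle of double area at most \<open>a\<close> (in
  units of the grid cell): for two points at sup-distance \<open>r\<close>, each line of the grid in the
  appropriate direction contains at most \<open>2a/r + 1\<close> suitable third points, and there are at most
  \<open>12r\<close> points at sup-distance \<open>r\<close> from a given one. A triple lies in \<open>(K\<^sup>2 - 3 choose n - 3)\<close>
  arrangements. So an area below \<open>c\<^sub>1 / (2\<^sup>\<delta> n\<^sup>3)\<close> yields an index of order
  \<open>c\<^sub>1 2\<^bsup>-\<delta>\<^esup> (K\<^sup>2 choose n)\<close>, and thus a description that is too short if \<open>c\<^sub>1\<close> is small compared
  with the constant of the universal machine.

  The decoder is written as a program with unbounded registers, whose elementary steps are steps of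
  a multi-tape Turing machine with one tape per register.
\<close>

section \<open>Counter programs\<close>

datatype instr = Nop | Inc nat | Dec nat | Adv_Prog | Adv_Cond | Emit bool

datatype test = Nonzero nat | More_Prog | Bit_Prog | Bit_Cond

datatype com = Skip | Do instr | Seq com com | Cond test com com | While test com

text \<open>
  The first two components of a store are the unread parts of the program and of the conditional
  information, the third is the output written so far, the last holds the registers.
\<close>

type_synonym store = "bool list \<times> bool list \<times> bool list \<times> (nat \<Rightarrow> nat)"

fun instr_sem :: "instr \<Rightarrow> store \<Rightarrow> store" where
  "instr_sem Nop \<sigma> = \<sigma>"
| "instr_sem (Inc i) (a, b, x, s) = (a, b, x, s(i := Suc (s i)))"
| "instr_sem (Dec i) (a, b, x, s) = (a, b, x, s(i := s i - 1))"
| "instr_sem Adv_Prog (a, b, x, s) = (tl a, b, x, s)"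
| "instr_sem Adv_Cond (a, b, x, s) = (a, tl b, x, s)"
| "instr_sem (Emit v) (a, b, x, s) = (a, b, x @ [v], s)"

fun test_sem :: "test \<Rightarrow> store \<Rightarrow> bool" where
  "test_sem (Nonzero i) (a, b, x, s) \<longleftrightarrow> s i \<noteq> 0"
| "test_sem More_Prog (a, b, x, s) \<longleftrightarrow> a \<noteq> []"
| "test_sem Bit_Prog (a, b, x, s) \<longleftrightarrow> a \<noteq> [] \<and> hd a"
| "test_sem Bit_Cond (a, b, x, s) \<longleftrightarrow> b \<noteq> [] \<and> hd b"

inductive exec :: "com \<Rightarrow> store \<Rightarrow> store \<Rightarrow> bool" where
  exec_Skip: "exec Skip \<sigma> \<sigma>"
| exec_Do: "exec (Do i) \<sigma> (instr_sem i \<sigma>)"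
| exec_Seq: "exec c \<sigma> \<sigma>' \<Longrightarrow> exec d \<sigma>' \<sigma>'' \<Longrightarrow> exec (Seq c d) \<sigma> \<sigma>''"
| exec_CondT: "test_sem t \<sigma> \<Longrightarrow> exec c \<sigma> \<sigma>' \<Longrightarrow> exec (Cond t c d) \<sigma> \<sigma>'"
| exec_CondF: "\<not> test_sem t \<sigma> \<Longrightarrow> exec d \<sigma> \<sigma>' \<Longrightarrow> exec (Cond t c d) \<sigma> \<sigma>'"
| exec_WhileF: "\<not> test_sem t \<sigma> \<Longrightarrow> exec (While t c) \<sigma> \<sigma>"
| exec_WhileT: "test_sem t \<sigma> \<Longrightarrow> exec c \<sigma> \<sigma>' \<Longrightarrow> exec (While t c) \<sigma>' \<sigma>'' \<Longrightarrow> exec (While t c) \<sigma> \<sigma>''"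

text \<open>Induction on the number of rounds still to come, because \<open>exec_WhileT\<close>
  peels off the first one. Loops are verified later by exhibiting the store
  \<open>\<sigma> k\<close> after \<open>k\<close> rounds.\<close>

lemma exec_While_iterate:
  assumes "\<And>k. k < n \<Longrightarrow> test_sem t (\<sigma> k)" "\<And>k. k < n \<Longrightarrow> exec c (\<sigma> k) (\<sigma> (Suc k))"
    and "\<not> test_sem t (\<sigma> n)"
  shows "exec (While t c) (\<sigma> 0) (\<sigma> n)"
proof -
  have "exec (While t c) (\<sigma> (n - k)) (\<sigma> n)" if "k \<le> n" for k
    using that
  proof (induction k)
    case 0
    then show ?case using assms(3) by (auto intro: exec_WhileF)
  next
    case (Suc k)
    then have *: "Suc (n - Suc k) = n - k" "n - Suc k < n" by auto
    show ?case
      using assms(1,2)[OF *(2)] Suc unfolding *(1) by (auto intro: exec_WhileT)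
  qed
  from this[of n] show ?thesis by simp
qed

section \<open>Simulation by Turing machines\<close>

text \<open>Test outcomes enter as a function \<open>\<phi>\<close>, so that the same control can be
  driven by the store or by the symbols scanned on the tapes. Only \<open>Skip\<close> has no
  successor; steps that merely move the control carry \<open>Nop\<close>.\<close>

fun next_step :: "com \<Rightarrow> (test \<Rightarrow> bool) \<Rightarrow> (com \<times> instr) option" where
  "next_step Skip \<phi> = None"
| "next_step (Do i) \<phi> = Some (Skip, i)"
| "next_step (Seq c d) \<phi> =
     (case next_step c \<phi> of None \<Rightarrow> Some (d, Nop) | Some (c', i) \<Rightarrow> Some (Seq c' d, i))"
| "next_step (Cond t c d) \<phi> = Some (if \<phi> t then c else d, Nop)"
| "next_step (While t c) \<phi> = Some (if \<phi> t then Seq c (While t c) else Skip, Nop)"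

definition small_step :: "com \<times> store \<Rightarrow> com \<times> store \<Rightarrow> bool" where
  "small_step = (\<lambda>(c, \<sigma>) (c', \<sigma>').
     \<exists>i. next_step c (\<lambda>t. test_sem t \<sigma>) = Some (c', i) \<and> \<sigma>' = instr_sem i \<sigma>)"

lemma small_steps_Seq:
  "small_step\<^sup>*\<^sup>* (c, \<sigma>) (c', \<sigma>') \<Longrightarrow> small_step\<^sup>*\<^sup>* (Seq c d, \<sigma>) (Seq c' d, \<sigma>')"
proof (induction "(c', \<sigma>')" arbitrary: c' \<sigma>' rule: rtranclp_induct)
  case base
  then show ?case by simp
next
  case (step y)
  obtain c1 \<sigma>1 where y: "y = (c1, \<sigma>1)" by (cases y) blast
  with step have "small_step\<^sup>*\<^sup>* (Seq c d, \<sigma>) (Seq c1 d, \<sigma>1)" by blast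
  moreover have "small_step (Seq c1 d, \<sigma>1) (Seq c' d, \<sigma>')"
    using step(2) unfolding y small_step_def by auto
  ultimately show ?case by (rule rtranclp.rtrancl_into_rtrancl)
qed

lemma exec_small_steps: "exec c \<sigma> \<sigma>' \<Longrightarrow> small_step\<^sup>*\<^sup>* (c, \<sigma>) (Skip, \<sigma>')"
proof (induction rule: exec.induct)
  case (exec_Seq c \<sigma> \<sigma>' d \<sigma>'')
  have "small_step (Seq Skip d, \<sigma>') (d, \<sigma>')" by (simp add: small_step_def)
  with small_steps_Seq[OF exec_Seq.IH(1), of d] exec_Seq.IH(2) show ?case
    by (meson converse_rtranclp_into_rtranclp rtranclp_trans)
next
  case (exec_WhileT t \<sigma> c \<sigma>' \<sigma>'')
  have "small_step (While t c, \<sigma>) (Seq c (While t c), \<sigma>)"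
    using exec_WhileT.hyps by (simp add: small_step_def)
  moreover have "small_step (Seq Skip (While t c), \<sigma>') (While t c, \<sigma>')" by (simp add: small_step_def)
  ultimately show ?case
    using small_steps_Seq[OF exec_WhileT.IH(1), of "While t c"] exec_WhileT.IH(2)
    by (meson converse_rtranclp_into_rtranclp rtranclp_trans)
next
  case (exec_CondT t \<sigma> c \<sigma>' d)
  then have "small_step (Cond t c d, \<sigma>) (c, \<sigma>)" by (simp add: small_step_def)
  with exec_CondT.IH show ?case by (rule converse_rtranclp_into_rtranclp[rotated])
next
  case (exec_CondF t \<sigma> d \<sigma>' c)
  then have "small_step (Cond t c d, \<sigma>) (d, \<sigma>)" by (simp add: small_step_def)
  with exec_CondF.IH show ?case by (rule converse_rtranclp_into_rtranclp[rotated])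
next
  case (exec_Do i \<sigma>)
  then show ?case by (intro r_into_rtranclp) (simp add: small_step_def)
next
  case (exec_WhileF t \<sigma> c)
  then show ?case by (intro r_into_rtranclp) (simp add: small_step_def)
qed simp

text \<open>The finitely many commands that can remain to be executed; they are the states of the machine.\<close>

fun residuals :: "com \<Rightarrow> com set" where
  "residuals Skip = {Skip}"
| "residuals (Do i) = {Do i, Skip}"
| "residuals (Seq c d) = (\<lambda>x. Seq x d) ` residuals c \<union> residuals d"
| "residuals (Cond t c d) = {Cond t c d} \<union> residuals c \<union> residuals d"
| "residuals (While t c) = {While t c, Skip} \<union> (\<lambda>x. Seq x (While t c)) ` residuals c"

lemma finite_residuals: "finite (residuals c)"
  by (induction c) auto

lemma residuals_refl: "c \<in> residuals c"
  by (induction c) auto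

lemma residuals_next_step:
  "next_step r \<phi> = Some (r', i) \<Longrightarrow> r \<in> residuals c \<Longrightarrow> r' \<in> residuals c"
  by (induction c arbitrary: r r') (auto split: option.splits if_splits simp: residuals_refl)

text \<open>A strict upper bound for the registers mentioned; its extension \<open>reg_bound\<close>
  to commands becomes the number of counter tapes.\<close>

fun instr_reg_bound :: "instr \<Rightarrow> nat" where
  "instr_reg_bound (Inc i) = Suc i"
| "instr_reg_bound (Dec i) = Suc i"
| "instr_reg_bound _ = 0"

fun test_reg_bound :: "test \<Rightarrow> nat" where
  "test_reg_bound (Nonzero i) = Suc i"
| "test_reg_bound _ = 0"

fun reg_bound :: "com \<Rightarrow> nat" where
  "reg_bound Skip = 0"
| "reg_bound (Do i) = instr_reg_bound i"
| "reg_bound (Seq c d) = max (reg_bound c) (reg_bound d)"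
| "reg_bound (Cond t c d) = max (test_reg_bound t) (max (reg_bound c) (reg_bound d))"
| "reg_bound (While t c) = max (test_reg_bound t) (reg_bound c)"

lemma reg_bound_residuals: "r \<in> residuals c \<Longrightarrow> reg_bound r \<le> reg_bound c"
  by (induction c arbitrary: r) (fastforce simp: le_max_iff_disj)+

lemma reg_bound_next_step: "next_step c \<phi> = Some (c', i) \<Longrightarrow> instr_reg_bound i \<le> reg_bound c"
  by (induction c arbitrary: c') (auto split: option.splits simp: le_max_iff_disj)

text \<open>Only tests occurring in the command are consulted. This lets the simulation replace
  tests of the store by tests of the scanned symbols, whose agreement is known only for registers
  that have a tape.\<close>

lemma next_step_cong:
  "(\<And>t. test_reg_bound t \<le> reg_bound c \<Longrightarrow> \<phi> t = \<psi> t) \<Longrightarrow> next_step c \<phi> = next_step c \<psi>"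
  by (induction c) (auto split: option.splits simp: le_max_iff_disj)

text \<open>A register is a tape marked only at its origin; its value is the head position.\<close>

definition counter_tape :: "nat \<Rightarrow> tape" where
  "counter_tape v = (int v, \<lambda>z. if z = 0 then Some True else None)"

text \<open>The offset 3 skips the program, condition and output tapes. A register is zero exactly
  when its head scans the mark, and a blank signals the end of an input.\<close>

fun test_symbols :: "test \<Rightarrow> bool option list \<Rightarrow> bool" where
  "test_symbols (Nonzero i) ss \<longleftrightarrow> ss ! (i + 3) \<noteq> Some True"
| "test_symbols More_Prog ss \<longleftrightarrow> ss ! 0 \<noteq> None"
| "test_symbols Bit_Prog ss \<longleftrightarrow> ss ! 0 = Some True"
| "test_symbols Bit_Cond ss \<longleftrightarrow> ss ! 1 = Some True"

definition keep :: "bool option list \<Rightarrow> (bool option \<times> head_move) list" where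
  "keep ss = map (\<lambda>a. (a, Move_None)) ss"

text \<open>The conditional moves realise the boundary cases: decrementing zero leaves the head on
  the mark, and advancing at a blank does nothing, matching \<open>tl [] = []\<close>.\<close>

fun instr_actions :: "instr \<Rightarrow> bool option list \<Rightarrow> (bool option \<times> head_move) list" where
  "instr_actions Nop ss = keep ss"
| "instr_actions (Inc i) ss = (keep ss)[i + 3 := (ss ! (i + 3), Move_Right)]"
| "instr_actions (Dec i) ss =
     (keep ss)[i + 3 := (ss ! (i + 3), if ss ! (i + 3) = Some True then Move_None else Move_Left)]"
| "instr_actions Adv_Prog ss =
     (keep ss)[0 := (ss ! 0, if ss ! 0 = None then Move_None else Move_Right)]"
| "instr_actions Adv_Cond ss =
     (keep ss)[1 := (ss ! 1, if ss ! 1 = None then Move_None else Move_Right)]"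
| "instr_actions (Emit v) ss = (keep ss)[2 := (Some v, Move_Right)]"

definition input_tape :: "bool list \<Rightarrow> bool list \<Rightarrow> tape \<Rightarrow> bool" where
  "input_tape p a T \<longleftrightarrow> (\<exists>h\<le>length p. T = (int h, string_contents p) \<and> a = drop h p)"

fun represents :: "bool list \<Rightarrow> bool list \<Rightarrow> nat \<Rightarrow> tape list \<Rightarrow> store \<Rightarrow> bool" where
  "represents p y R ts (a, b, x, s) \<longleftrightarrow>
     (\<exists>T0 T1. input_tape p a T0 \<and> input_tape y b T1 \<and>
        ts = T0 # T1 # (int (length x), string_contents x) # map (\<lambda>i. counter_tape (s i)) [0..<R])"

section \<open>Agreement of tape actions with the instructions\<close>

lemma tape_read_input_tape:
  "input_tape p a T \<Longrightarrow> tape_read T = (if a = [] then None else Some (hd a))"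
  by (auto simp: input_tape_def string_contents_def hd_drop_conv_nth)

lemma tape_read_counter_tape: "tape_read (counter_tape v) = (if v = 0 then Some True else None)"
  by (simp add: counter_tape_def)

lemma represents_test:
  assumes "represents p y R ts \<sigma>" "test_reg_bound t \<le> R"
  shows "test_symbols t (map tape_read ts) = test_sem t \<sigma>"
  using assms
  by (cases t; cases \<sigma>)
    (auto simp: tape_read_input_tape tape_read_counter_tape simp del: tape_read.simps split: if_splits)

lemma tape_act_keep: "tape_act (tape_read T, Move_None) T = T"
  by (cases T) auto

lemma map2_keep: "map2 tape_act (keep (map tape_read ts)) ts = ts"
  by (induction ts) (auto simp: keep_def tape_act_keep)

lemma map2_keep_update:
  assumes "i < length ts"
  shows "map2 tape_act ((keep (map tape_read ts))[i := a]) ts = ts[i := tape_act a (ts ! i)]"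
proof -
  have "map2 tape_act ((keep (map tape_read ts))[i := a]) ts
    = map2 tape_act ((keep (map tape_read ts))[i := a]) (ts[i := ts ! i])" by simp
  also have "\<dots> = (map2 tape_act (keep (map tape_read ts)) ts)[i := tape_act a (ts ! i)]"
    using assms by (subst zip_update) (simp add: map_update)
  finally show ?thesis by (simp add: map2_keep)
qed

lemma input_tape_advance:
  assumes "input_tape p a T"
  shows "input_tape p (tl a)
    (tape_act (tape_read T, if tape_read T = None then Move_None else Move_Right) T)"
proof -
  obtain h where h: "h \<le> length p" "T = (int h, string_contents p)" "a = drop h p"
    using assms by (auto simp: input_tape_def)
  show ?thesis
  proof (cases "h = length p")
    case True
    then show ?thesis using h by (auto simp: input_tape_def string_contents_def)
  next
    case False
    then have "tape_read T \<noteq> None" using h by (auto simp: string_contents_def)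
    then show ?thesis using h False
      by (auto simp: input_tape_def tl_drop drop_Suc intro!: exI[of _ "Suc h"])
  qed
qed

lemma string_contents_snoc:
  "(string_contents x)(int (length x) := Some v) = string_contents (x @ [v])"
  by (auto simp: string_contents_def fun_eq_iff nth_append)

lemma tape_act_counter_Inc:
  "tape_act (tape_read (counter_tape v), Move_Right) (counter_tape v) = counter_tape (Suc v)"
  by (auto simp: counter_tape_def)

lemma tape_act_counter_Dec:
  "tape_act (tape_read (counter_tape v), if tape_read (counter_tape v) = Some True then Move_None
     else Move_Left) (counter_tape v) = counter_tape (v - 1)"
  by (auto simp: counter_tape_def)

lemma map_counter_update:
  "(map (\<lambda>i. counter_tape (s i)) [0..<R])[j := counter_tape v] =
   map (\<lambda>i. counter_tape ((s(j := v)) i)) [0..<R]"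
  by (rule nth_equalityI) (auto simp: nth_list_update)

text \<open>Every instruction changes at most one tape, so each case reduces to a single list
  update.\<close>

lemma represents_instr:
  assumes "represents p y R ts \<sigma>" "instr_reg_bound i \<le> R"
  shows "represents p y R (map2 tape_act (instr_actions i (map tape_read ts)) ts) (instr_sem i \<sigma>)"
proof -
  obtain a b x s where \<sigma>: "\<sigma> = (a, b, x, s)" by (cases \<sigma>) auto
  with assms(1) obtain T0 T1 where
    T: "input_tape p a T0" "input_tape y b T1"
    and ts: "ts = T0 # T1 # (int (length x), string_contents x) # map (\<lambda>i. counter_tape (s i)) [0..<R]"
    by auto
  have len: "length ts = R + 3" using ts by simp
  show ?thesis
  proof (cases i)
    case Nop
    then show ?thesis using assms by (simp add: map2_keep)
  next
    case (Inc j)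
    with assms len have j: "j + 3 < length ts" "j < R" by auto
    have nth: "ts ! (j + 3) = counter_tape (s j)" using j ts by simp
    show ?thesis using T j unfolding Inc instr_actions.simps map2_keep_update[OF j(1)] nth_map[OF j(1)]
        nth tape_act_counter_Inc \<sigma>
      by (simp add: ts map_counter_update numeral_3_eq_3 del: fun_upd_apply upt_Suc split_paired_Ex)
  next
    case (Dec j)
    with assms len have j: "j + 3 < length ts" "j < R" by auto
    have nth: "ts ! (j + 3) = counter_tape (s j)" using j ts by simp
    show ?thesis using T j unfolding Dec instr_actions.simps map2_keep_update[OF j(1)] nth_map[OF j(1)]
        nth tape_act_counter_Dec \<sigma>
      by (simp add: ts map_counter_update numeral_3_eq_3 del: fun_upd_apply upt_Suc split_paired_Ex)
  next
    case Adv_Prog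
    have j: "0 < length ts" using len by simp
    show ?thesis using T input_tape_advance[OF T(1)]
      unfolding Adv_Prog instr_actions.simps map2_keep_update[OF j] nth_map[OF j] \<sigma>
      by (simp add: ts del: split_paired_Ex)
  next
    case Adv_Cond
    have j: "1 < length ts" using len by simp
    show ?thesis using T input_tape_advance[OF T(2)]
      unfolding Adv_Cond instr_actions.simps map2_keep_update[OF j] nth_map[OF j] \<sigma>
      by (simp add: ts del: split_paired_Ex)
  next
    case (Emit v)
    have j: "2 < length ts" using len by simp
    show ?thesis using T
      unfolding Emit instr_actions.simps map2_keep_update[OF j] nth_map[OF j] \<sigma>
      by (simp add: ts string_contents_snoc del: split_paired_Ex)
  qed
qed

text \<open>State \<open>0\<close> marks the origin of all counter tapes, state \<open>Suc q\<close> stands for the residual \<open>L ! q\<close>.\<close>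

definition compile_tm :: "nat \<Rightarrow> com list \<Rightarrow> tm" where
  "compile_tm R L = \<lparr>tm_states = Suc (length L), tm_tapes = R + 3, tm_delta = (\<lambda>q ss.
     if q = 0 then Some (1, keep (take 3 ss) @ replicate R (Some True, Move_None))
     else case next_step (L ! (q - 1)) (\<lambda>t. test_symbols t ss) of
       None \<Rightarrow> None
     | Some (r, i) \<Rightarrow> Some (Suc (LEAST q'. L ! q' = r), instr_actions i ss))\<rparr>"

lemma length_instr_actions: "length (instr_actions i ss) = length ss"
  by (cases i) (auto simp: keep_def)

text \<open>Beyond the end of the list \<open>L ! q\<close> is unspecified, but the least witness
  cannot exceed a genuine index.\<close>

lemma index_of_element:
  assumes "r \<in> set L"
  shows "(LEAST q. L ! q = r) < length L" "L ! (LEAST q. L ! q = r) = r"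
proof -
  obtain q where q: "q < length L" "L ! q = r" using assms by (auto simp: in_set_conv_nth)
  show "L ! (LEAST q. L ! q = r) = r" using q by (intro LeastI)
  show "(LEAST q. L ! q = r) < length L" using Least_le[of "\<lambda>q. L ! q = r", OF q(2)] q(1) by simp
qed

text \<open>Forward simulation: after one marking step, each small step is matched by one machine
  step. The machine depends on \<open>c\<close> alone and serves all inputs.\<close>

lemma exec_imp_tm_outputs:
  obtains T where "turing_machine T"
    "\<And>p y a b x s. exec c (p, y, [], \<lambda>_. 0) (a, b, x, s) \<Longrightarrow> tm_outputs T p y x"
proof -
  obtain L' where L': "set L' = residuals c" using finite_list[OF finite_residuals] by blast
  \<comment> \<open>With \<open>c\<close> in front, state 1 is its entry point, which the marking
    state 0 leads to.\<close>
  define L where "L = c # L'"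
  define R where "R = reg_bound c"
  define T where "T = compile_tm R L"
  have L: "set L = residuals c" using L' residuals_refl by (auto simp: L_def)
  have closed: "r' \<in> set L" if "r \<in> set L" "next_step r \<phi> = Some (r', i)" for r r' \<phi> i
    using residuals_next_step that unfolding L by blast
  have "turing_machine T"
    unfolding turing_machine_def
  proof (intro conjI allI impI)
    fix q ss q' as
    assume *: "q < tm_states T \<and> length ss = tm_tapes T \<and> tm_delta T q ss = Some (q', as)"
    have "q' < tm_states T \<and> length as = tm_tapes T"
    proof (cases "q = 0")
      case True
      then show ?thesis using * by (auto simp: T_def compile_tm_def keep_def L_def)
    next
      case False
      then obtain r i where r: "next_step (L ! (q - 1)) (\<lambda>t. test_symbols t ss) = Some (r, i)"
        and q': "q' = Suc (LEAST q'. L ! q' = r)" "as = instr_actions i ss"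
        using * by (auto simp: T_def compile_tm_def split: option.splits)
      have "L ! (q - 1) \<in> set L" using * False by (intro nth_mem) (auto simp: T_def compile_tm_def)
      from closed[OF this r] have "r \<in> set L" .
      then show ?thesis using index_of_element(1)[of r L] q' *
        by (auto simp: length_instr_actions T_def compile_tm_def)
    qed
    then show "q' < tm_states T" "length as = tm_tapes T" by auto
  qed (auto simp: T_def compile_tm_def)
  moreover have "tm_outputs T p y x" if ex: "exec c (p, y, [], \<lambda>_. 0) (a, b, x, s)" for p y a b x s
  proof -
    define rel where "rel = (\<lambda>(q, ts) (r, \<sigma>). \<exists>q'. q = Suc q' \<and> q' < length L \<and> L ! q' = r \<and> represents p y R ts \<sigma>)"
    let ?step = "\<lambda>c d. tm_step T c = Some d"
    have next_eq: "next_step (L ! q) (\<lambda>t. test_symbols t (map tape_read ts)) =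
        next_step (L ! q) (\<lambda>t. test_sem t \<sigma>)"
      if "q < length L" "represents p y R ts \<sigma>" for q ts \<sigma>
    proof (rule next_step_cong)
      fix t assume "test_reg_bound t \<le> reg_bound (L ! q)"
      also have "\<dots> \<le> R" using that L nth_mem[of q L] reg_bound_residuals unfolding R_def by blast
      finally show "test_symbols t (map tape_read ts) = test_sem t \<sigma>"
        using represents_test that by blast
    qed
    have sim: "\<exists>d. ?step C d \<and> rel d D'" if rel: "rel C D" and st: "small_step D D'" for C D D'
    proof -
      obtain q0 ts r0 \<sigma> where CD: "C = (q0, ts)" "D = (r0, \<sigma>)" by (cases C, cases D) blast
      then have "\<exists>q. q0 = Suc q \<and> q < length L \<and> L ! q = r0 \<and> represents p y R ts \<sigma>"
        using rel by (simp add: rel_def)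
      with CD obtain q where C: "C = (Suc q, ts)" "q < length L" "D = (L ! q, \<sigma>)" "represents p y R ts \<sigma>"
        by auto
      obtain r i where r: "next_step (L ! q) (\<lambda>t. test_sem t \<sigma>) = Some (r, i)" "D' = (r, instr_sem i \<sigma>)"
        using st C by (cases D') (auto simp: small_step_def)
      have "L ! q \<in> set L" using C by simp
      from closed[OF this r(1)] have "r \<in> set L" .
      note idx = index_of_element[OF this]
      have "instr_reg_bound i \<le> reg_bound (L ! q)" using reg_bound_next_step r(1) .
      also have "\<dots> \<le> R" using C L nth_mem[of q L] reg_bound_residuals unfolding R_def by blast
      finally have "represents p y R (map2 tape_act (instr_actions i (map tape_read ts)) ts) (instr_sem i \<sigma>)"
        using represents_instr C by blast
      moreover have "tm_step T C = Some (Suc (LEAST q'. L ! q' = r), map2 tape_act (instr_actions i (map tape_read ts)) ts)"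
        using r(1) next_eq[OF C(2,4)] by (simp add: C T_def compile_tm_def)
      ultimately show ?thesis using idx r by (auto simp: rel_def)
    qed
    have sims: "\<exists>d. ?step\<^sup>*\<^sup>* C d \<and> rel d D'" if "small_step\<^sup>*\<^sup>* D D'" "rel C D" for C D D'
      using that
    proof (induction rule: rtranclp_induct)
      case base
      then show ?case by blast
    next
      case (step D1 D2)
      then obtain d where d: "?step\<^sup>*\<^sup>* C d" "rel d D1" by blast
      with sim step.hyps obtain d' where "?step d d'" "rel d' D2" by blast
      with d show ?case by (meson rtranclp.rtrancl_into_rtrancl)
    qed
    \<comment> \<open>The tapes right after the marking step, when every register tape represents
      0.\<close>
    define ts where "ts = (0, string_contents p) # (0, string_contents y) # (0, string_contents []) #
        replicate R (counter_tape 0)"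
    have mark: "tape_act (Some True, Move_None) (0, string_contents []) = counter_tape 0"
      by (auto simp: string_contents_def counter_tape_def)
    have mark': "map2 tape_act (replicate R (Some True, Move_None)) (replicate R (0, string_contents [])) =
        replicate R (counter_tape 0)"
      by (simp add: zip_replicate mark del: tape_act.simps)
    have init: "?step (tm_init T p y) (1, ts)"
      using mark' by (simp add: tm_init_def T_def compile_tm_def ts_def keep_def eval_nat_numeral)
    have "represents p y R ts (p, y, [], \<lambda>_. 0)"
      by (auto simp: ts_def input_tape_def map_replicate_const)
    then have "rel (1, ts) (c, (p, y, [], \<lambda>_. 0))" by (auto simp: rel_def L_def)
    with sims[OF exec_small_steps[OF ex]] obtain d where
      d: "?step\<^sup>*\<^sup>* (1, ts) d" "rel d (Skip, (a, b, x, s))" by blast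
    obtain q ts' where q: "d = (Suc q, ts')" "q < length L" "L ! q = Skip" "represents p y R ts' (a, b, x, s)"
      using d(2) by (cases d) (auto simp: rel_def)
    \<comment> \<open>\<open>Skip\<close> has no next step, so the machine halts here.\<close>
    have "tm_step T d = None" by (simp add: q T_def compile_tm_def)
    moreover have "?step\<^sup>*\<^sup>* (tm_init T p y) d" using init d(1) by (rule converse_rtranclp_into_rtranclp)
    moreover have "snd (ts' ! 2) = string_contents x" using q(4) by auto
    ultimately show ?thesis unfolding tm_outputs_def q(1) by blast
  qed
  ultimately show ?thesis using that by blast
qed

section \<open>Primitive recursive functions of registers\<close>

definition runs :: "com \<Rightarrow> (nat \<Rightarrow> nat) \<Rightarrow> (nat \<Rightarrow> nat) \<Rightarrow> bool" where
  "runs c s s' \<longleftrightarrow> (\<forall>a b x. exec c (a, b, x, s) (a, b, x, s'))"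

lemma runs_Inc: "s' = s(i := Suc (s i)) \<Longrightarrow> runs (Do (Inc i)) s s'"
  using exec_Do[of "Inc i" "(a, b, x, s)" for a b x] by (simp add: runs_def)

lemma runs_Dec: "s' = s(i := s i - 1) \<Longrightarrow> runs (Do (Dec i)) s s'"
  using exec_Do[of "Dec i" "(a, b, x, s)" for a b x] by (simp add: runs_def)

lemma runs_Seq: "runs c s s' \<Longrightarrow> runs d s' s'' \<Longrightarrow> runs (Seq c d) s s''"
  unfolding runs_def by (blast intro: exec_Seq)

text \<open>Entry and exit stores are linked to \<open>S\<close> by equations, because updated
  stores often agree with the closed form only after an extensionality argument.\<close>

lemma runs_While:
  assumes "\<And>k. k < n \<Longrightarrow> S k i \<noteq> 0" "\<And>k. k < n \<Longrightarrow> runs c (S k) (S (Suc k))" "S n i = 0"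
    and "s = S 0" "s' = S n"
  shows "runs (While (Nonzero i) c) s s'"
  unfolding runs_def assms(4,5)
proof (intro allI)
  fix a b x
  show "exec (While (Nonzero i) c) (a, b, x, S 0) (a, b, x, S n)"
    using exec_While_iterate[of n "Nonzero i" "\<lambda>k. (a, b, x, S k)" c] assms by (simp add: runs_def)
qed

section \<open>Clearing, moving and copying registers\<close>

definition clear_reg :: "nat \<Rightarrow> com" where
  "clear_reg i = While (Nonzero i) (Do (Dec i))"

lemma runs_clear_reg: "s' = s(i := 0) \<Longrightarrow> runs (clear_reg i) s s'"
  unfolding clear_reg_def
  by (rule runs_While[where n = "s i" and S = "\<lambda>k. s(i := s i - k)"]) (auto intro!: runs_Dec)

definition move_reg :: "nat \<Rightarrow> nat \<Rightarrow> com" where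
  "move_reg i j = While (Nonzero i) (Seq (Do (Dec i)) (Do (Inc j)))"

lemma runs_move_reg:
  assumes "i \<noteq> j" "s' = s(j := s j + s i, i := 0)"
  shows "runs (move_reg i j) s s'"
  unfolding move_reg_def
proof (rule runs_While[where n = "s i" and S = "\<lambda>k. s(j := s j + k, i := s i - k)"])
  show "runs (Seq (Do (Dec i)) (Do (Inc j))) (s(j := s j + k, i := s i - k))
    (s(j := s j + Suc k, i := s i - Suc k))" for k
    by (rule runs_Seq[OF runs_Dec[OF refl] runs_Inc]) (use assms in auto)
qed (use assms in auto)

text \<open>Counting a register down destroys it, so its value is added both to \<open>j\<close> and
  to the scratch register \<open>t\<close>, from which \<open>i\<close> is restored.\<close>

definition copy_reg :: "nat \<Rightarrow> nat \<Rightarrow> nat \<Rightarrow> com" where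
  "copy_reg i j t = Seq (While (Nonzero i) (Seq (Do (Dec i)) (Seq (Do (Inc j)) (Do (Inc t))))) (move_reg t i)"

lemma runs_copy_reg:
  assumes "i \<noteq> j" "i \<noteq> t" "j \<noteq> t" "s t = 0" "s' = s(j := s j + s i)"
  shows "runs (copy_reg i j t) s s'"
  unfolding copy_reg_def
proof (rule runs_Seq)
  show "runs (While (Nonzero i) (Seq (Do (Dec i)) (Seq (Do (Inc j)) (Do (Inc t))))) s
    (s(j := s j + s i, t := s i, i := 0))"
  proof (rule runs_While[where n = "s i" and S = "\<lambda>k. s(j := s j + k, t := k, i := s i - k)"])
    show "runs (Seq (Do (Dec i)) (Seq (Do (Inc j)) (Do (Inc t)))) (s(j := s j + k, t := k, i := s i - k))
      (s(j := s j + Suc k, t := Suc k, i := s i - Suc k))" for k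
      by (rule runs_Seq[OF runs_Dec[OF refl] runs_Seq[OF runs_Inc[OF refl] runs_Inc]])
        (use assms in auto)
  qed (use assms in auto)
  show "runs (move_reg t i) (s(j := s j + s i, t := s i, i := 0)) s'"
    using assms by (intro runs_move_reg) (auto simp: fun_eq_iff)
qed

text \<open>
  The register \<open>t\<close> is both the destination and the bottom of the scratch stack. It is arbitrary
  because inside a recursion the registers from \<open>d\<close> on hold the loop variables.
\<close>

definition computable :: "nat \<Rightarrow> ((nat \<Rightarrow> nat) \<Rightarrow> nat) \<Rightarrow> bool" where
  "computable d f \<longleftrightarrow> (\<forall>s s'. (\<forall>i<d. s i = s' i) \<longrightarrow> f s = f s') \<and>
     (\<forall>t\<ge>d. \<exists>c. \<forall>s. (\<forall>i\<ge>t. s i = 0) \<longrightarrow> runs c s (s(t := f s)))"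

lemma computable_local: "computable d f \<Longrightarrow> (\<And>i. i < d \<Longrightarrow> s i = s' i) \<Longrightarrow> f s = f s'"
  unfolding computable_def by blast

lemma computable_runs:
  assumes "computable d f" "d \<le> t"
  obtains c where "\<And>s. (\<And>i. i \<ge> t \<Longrightarrow> s i = 0) \<Longrightarrow> runs c s (s(t := f s))"
  using assms unfolding computable_def by blast

lemma computable_mono: "computable d f \<Longrightarrow> d \<le> d' \<Longrightarrow> computable d' f"
  unfolding computable_def by (meson order_less_le_trans order_trans)

lemma computable_reg: "i < d \<Longrightarrow> computable d (\<lambda>s. s i)"
  unfolding computable_def
proof (intro conjI allI impI)
  fix t assume "i < d" "d \<le> t"
  then show "\<exists>c. \<forall>s. (\<forall>i\<ge>t. s i = 0) \<longrightarrow> runs c s (s(t := s i))"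
    by (intro exI[of _ "copy_reg i t (Suc t)"] allI impI runs_copy_reg) auto
qed simp

lemma computable_0: "computable d (\<lambda>s. 0)"
  unfolding computable_def
proof (intro conjI allI impI)
  fix t
  show "\<exists>c. \<forall>s. (\<forall>i\<ge>t. s i = 0) \<longrightarrow> runs c s (s(t := 0))"
    by (intro exI[of _ "clear_reg t"] allI impI runs_clear_reg) auto
qed simp

lemma computable_Suc:
  assumes "computable d f"
  shows "computable d (\<lambda>s. Suc (f s))"
  unfolding computable_def
proof (intro conjI allI impI)
  show "Suc (f s) = Suc (f s')" if "\<forall>i<d. s i = s' i" for s s'
    using computable_local[OF assms, of s s'] that by simp
  fix t assume t: "d \<le> t"
  obtain c where "\<And>s. (\<And>i. i \<ge> t \<Longrightarrow> s i = 0) \<Longrightarrow> runs c s (s(t := f s))"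
    using computable_runs[OF assms t] by blast
  then show "\<exists>c. \<forall>s. (\<forall>i\<ge>t. s i = 0) \<longrightarrow> runs c s (s(t := Suc (f s)))"
    by (intro exI[of _ "Seq c (Do (Inc t))"] allI impI runs_Seq[OF _ runs_Inc]) auto
qed

lemma computable_const: "computable d (\<lambda>s. n)"
  by (induction n) (auto intro: computable_0 computable_Suc)

text \<open>Register \<open>t\<close> holds the accumulator, \<open>t + 1\<close> the loop index,
  \<open>t + 2\<close> the number of rounds left, and \<open>t + 3\<close> receives the value of the
  body. The body is assumed computable for every \<open>t\<close> from \<open>d\<close> on because
  the bottom of the scratch stack varies.\<close>

lemma computable_rec:
  assumes z: "computable d z" and n: "computable d n"
    and body: "\<And>t. d \<le> t \<Longrightarrow> computable (t + 2) (\<lambda>s. b s (s (t + 1)) (s t))"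
    and local: "\<And>s s' k r. (\<And>i. i < d \<Longrightarrow> s i = s' i) \<Longrightarrow> b s k r = b s' k r"
  shows "computable d (\<lambda>s. rec_nat (z s) (b s) (n s))"
  unfolding computable_def
proof (intro conjI allI impI)
  show "rec_nat (z s) (b s) (n s) = rec_nat (z s') (b s') (n s')" if "\<forall>i<d. s i = s' i" for s s'
  proof -
    have "b s = b s'" using local that by blast
    then show ?thesis using computable_local[OF z, of s s'] computable_local[OF n, of s s'] that by simp
  qed
  fix t assume t: "d \<le> t"
  obtain cz where cz: "\<And>s. (\<And>i. i \<ge> t \<Longrightarrow> s i = 0) \<Longrightarrow> runs cz s (s(t := z s))"
    using computable_runs[OF z t] by blast
  obtain cn where cn: "\<And>s. (\<And>i. i \<ge> t + 2 \<Longrightarrow> s i = 0) \<Longrightarrow> runs cn s (s(t + 2 := n s))"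
    using computable_runs[OF n, of "t + 2"] t by auto
  obtain cb where cb: "\<And>s. (\<And>i. i \<ge> t + 3 \<Longrightarrow> s i = 0) \<Longrightarrow>
      runs cb s (s(t + 3 := b s (s (t + 1)) (s t)))"
    using computable_runs[OF body[OF t], of "t + 3"] by auto
  define loop where "loop = Seq cb (Seq (clear_reg t) (Seq (move_reg (t + 3) t)
    (Seq (Do (Inc (t + 1))) (Do (Dec (t + 2))))))"
  define c where "c = Seq cz (Seq cn (Seq (While (Nonzero (t + 2)) loop) (clear_reg (t + 1))))"
  have "runs c s (s(t := rec_nat (z s) (b s) (n s)))" if s0: "\<forall>i\<ge>t. s i = 0" for s
    unfolding c_def
  proof (intro runs_Seq)
    define S where "S k = s(t := rec_nat (z s) (b s) k, t + 1 := k, t + 2 := n s - k)" for k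
    show "runs cz s (s(t := z s))" using cz s0 by simp
    \<comment> \<open>The bound is evaluated after \<open>t\<close> has been overwritten, which is
      harmless as it reads only registers below \<open>d\<close>.\<close>
    have "n (s(t := z s)) = n s" using t by (intro computable_local[OF n]) auto
    moreover have "S 0 = s(t := z s, t + 2 := n s)" using s0 by (auto simp: S_def fun_eq_iff)
    ultimately show "runs cn (s(t := z s)) (S 0)"
      using cn[of "s(t := z s)"] s0 by simp
    have "runs loop (S k) (S (Suc k))" if "k < n s" for k
      unfolding loop_def
    proof (intro runs_Seq)
      have "b (S k) = b s" by (intro ext local) (use t in \<open>simp add: S_def\<close>)
      then have "b (S k) (S k (t + 1)) (S k t) = b s k (rec_nat (z s) (b s) k)" by (simp add: S_def)
      then show "runs cb (S k) ((S k)(t + 3 := rec_nat (z s) (b s) (Suc k)))"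
        using cb[of "S k"] s0 by (simp add: S_def)
      show "runs (clear_reg t) ((S k)(t + 3 := rec_nat (z s) (b s) (Suc k)))
        ((S k)(t + 3 := rec_nat (z s) (b s) (Suc k), t := 0))"
        by (rule runs_clear_reg) simp
      show "runs (move_reg (t + 3) t) ((S k)(t + 3 := rec_nat (z s) (b s) (Suc k), t := 0))
        ((S k)(t := rec_nat (z s) (b s) (Suc k)))"
        using s0 by (intro runs_move_reg) (auto simp: fun_eq_iff S_def)
      show "runs (Do (Inc (t + 1))) ((S k)(t := rec_nat (z s) (b s) (Suc k)))
        ((S k)(t := rec_nat (z s) (b s) (Suc k), t + 1 := Suc k))"
        by (rule runs_Inc) (simp add: S_def)
      show "runs (Do (Dec (t + 2))) ((S k)(t := rec_nat (z s) (b s) (Suc k), t + 1 := Suc k))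
        (S (Suc k))"
        by (rule runs_Dec) (auto simp: S_def fun_eq_iff)
    qed
    then show "runs (While (Nonzero (t + 2)) loop) (S 0) (S (n s))"
      by (intro runs_While[where S = S and n = "n s"]) (auto simp: S_def)
    show "runs (clear_reg (t + 1)) (S (n s)) (s(t := rec_nat (z s) (b s) (n s)))"
      using s0 by (intro runs_clear_reg) (auto simp: S_def fun_eq_iff)
  qed
  then show "\<exists>c. \<forall>s. (\<forall>i\<ge>t. s i = 0) \<longrightarrow> runs c s (s(t := rec_nat (z s) (b s) (n s)))" by blast
qed

text \<open>The assumption on \<open>b\<close> binds its own \<open>d\<close>, since the body runs
  with additional registers for the loop variables. Passing argument functions lets the closure
  lemmas discharge it directly.\<close>

lemma computable_rec_params:
  assumes "computable d z" "computable d n" "computable d f" "computable d g"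
    and "\<And>d x y k r. computable d x \<Longrightarrow> computable d y \<Longrightarrow> computable d k \<Longrightarrow> computable d r \<Longrightarrow>
      computable d (\<lambda>s. b (x s) (y s) (k s) (r s))"
  shows "computable d (\<lambda>s. rec_nat (z s) (b (f s) (g s)) (n s))"
proof (rule computable_rec)
  show "computable (t + 2) (\<lambda>s. b (f s) (g s) (s (t + 1)) (s t))" if "d \<le> t" for t
    using that by (intro assms(5) computable_reg computable_mono[OF assms(3)] computable_mono[OF assms(4)]) auto
  show "b (f s) (g s) k r = b (f s') (g s') k r" if "\<And>i. i < d \<Longrightarrow> s i = s' i" for s s' k r
    using computable_local[OF assms(3), of s s'] computable_local[OF assms(4), of s s'] that by simp
qed fact+

section \<open>Arithmetic and comparisons by primitive recursion\<close>

lemma computable_add: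
  assumes "computable d f" "computable d g"
  shows "computable d (\<lambda>s. f s + g s)"
proof -
  have "computable d (\<lambda>s. rec_nat (f s) (\<lambda>k r. Suc r) (g s))"
    by (intro computable_rec_params[where b = "\<lambda>x y k r. Suc r" and f = "\<lambda>s. 0" and g = "\<lambda>s. 0"] computable_Suc assms computable_0)
  moreover have "rec_nat x (\<lambda>k r. Suc r) y = x + y" for x y :: nat by (induction y) auto
  ultimately show ?thesis by simp
qed

lemma computable_mult:
  assumes "computable d f" "computable d g"
  shows "computable d (\<lambda>s. f s * g s)"
proof -
  have "computable d (\<lambda>s. rec_nat 0 (\<lambda>k r. r + f s) (g s))"
    by (intro computable_rec_params[where b = "\<lambda>x y k r. r + x" and f = "\<lambda>s. f s" and g = "\<lambda>s. 0"] computable_add assms computable_0)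
  moreover have "rec_nat 0 (\<lambda>k r. r + x) y = x * y" for x y :: nat by (induction y) auto
  ultimately show ?thesis by simp
qed

lemma computable_power:
  assumes "computable d f" "computable d g"
  shows "computable d (\<lambda>s. f s ^ g s)"
proof -
  have "computable d (\<lambda>s. rec_nat 1 (\<lambda>k r. r * f s) (g s))"
    by (intro computable_rec_params[where b = "\<lambda>x y k r. r * x" and f = "\<lambda>s. f s" and g = "\<lambda>s. 0"] computable_mult assms computable_const)
  moreover have "rec_nat 1 (\<lambda>k r. r * x) y = x ^ y" for x y :: nat by (induction y) auto
  ultimately show ?thesis by simp
qed

lemma computable_pred:
  assumes "computable d f"
  shows "computable d (\<lambda>s. f s - 1)"
proof -
  have "computable d (\<lambda>s. rec_nat 0 (\<lambda>k r. k) (f s))"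
    by (intro computable_rec_params[where b = "\<lambda>x y k r. k" and f = "\<lambda>s. 0" and g = "\<lambda>s. 0"] assms computable_0)
  moreover have "rec_nat 0 (\<lambda>k r. k) y = y - 1" for y :: nat by (induction y) auto
  ultimately show ?thesis by simp
qed

lemma computable_diff:
  assumes "computable d f" "computable d g"
  shows "computable d (\<lambda>s. f s - g s)"
proof -
  have "computable d (\<lambda>s. rec_nat (f s) (\<lambda>k r. r - 1) (g s))"
    by (intro computable_rec_params[where b = "\<lambda>x y k r. r - 1" and f = "\<lambda>s. 0" and g = "\<lambda>s. 0"] computable_pred assms computable_0)
  moreover have "rec_nat x (\<lambda>k r. r - 1) y = x - y" for x y :: nat by (induction y) auto
  ultimately show ?thesis by simp
qed

lemma computable_le:
  assumes "computable d f" "computable d g"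
  shows "computable d (\<lambda>s. of_bool (f s \<le> g s))"
proof -
  have "computable d (\<lambda>s. 1 - (f s - g s))"
    by (intro computable_diff assms computable_const)
  moreover have "1 - (x - y) = of_bool (x \<le> y)" for x y :: nat by auto
  ultimately show ?thesis by simp
qed

lemma computable_conj:
  assumes "computable d (\<lambda>s. of_bool (P s))" "computable d (\<lambda>s. of_bool (Q s))"
  shows "computable d (\<lambda>s. of_bool (P s \<and> Q s))"
  using computable_mult[OF assms] by (simp add: of_bool_conj)

lemma computable_less:
  assumes "computable d f" "computable d g"
  shows "computable d (\<lambda>s. of_bool (f s < g s))"
  using computable_le[OF computable_Suc[OF assms(1)] assms(2)] by (simp add: Suc_le_eq)

lemma computable_eq:
  assumes "computable d f" "computable d g"
  shows "computable d (\<lambda>s. of_bool (f s = g s))"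
  using computable_conj[OF computable_le[OF assms] computable_le[OF assms(2,1)]]
  by (simp add: order.eq_iff[of "f s" "g s" for s])

lemma computable_sum:
  assumes "computable d n" "computable d f" "computable d g"
    and "\<And>d x y k. computable d x \<Longrightarrow> computable d y \<Longrightarrow> computable d k \<Longrightarrow>
      computable d (\<lambda>s. h (x s) (y s) (k s))"
  shows "computable d (\<lambda>s. \<Sum>k<n s. h (f s) (g s) k)"
proof -
  have "computable d (\<lambda>s. rec_nat 0 (\<lambda>k r. r + h (f s) (g s) k) (n s))"
    by (intro computable_rec_params[where b = "\<lambda>x y k r. r + h x y k" and f = f and g = g] computable_add assms computable_0)
  moreover have "rec_nat 0 (\<lambda>k r. r + F k) m = (\<Sum>k<m. F k)" for F :: "nat \<Rightarrow> nat" and m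
    by (induction m) auto
  ultimately show ?thesis by simp
qed

text \<open>The quotient is the number of positive multiples of the divisor up to the dividend. The
  conjunct \<open>0 < g s\<close> reproduces the convention \<open>x div 0 = 0\<close>.\<close>

lemma computable_div:
  assumes "computable d f" "computable d g"
  shows "computable d (\<lambda>s. f s div g s)"
proof -
  have "computable d (\<lambda>s. \<Sum>k<f s. of_bool (0 < g s \<and> Suc k * g s \<le> f s))"
    by (rule computable_sum[where h = "\<lambda>x y k. of_bool (0 < y \<and> Suc k * y \<le> x)"])
      (intro assms computable_conj computable_less computable_le computable_mult computable_Suc
        computable_0 | assumption)+
  moreover have "(\<Sum>k<x. of_bool (0 < y \<and> Suc k * y \<le> x)) = x div y" for x y :: nat
  proof (cases "y = 0")
    case False
    then have "{k. k < x \<and> Suc k * y \<le> x} = {..<x div y}"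
      using less_eq_div_iff_mult_less_eq[of y "Suc k" x for k]
      by (auto simp: Suc_le_eq intro: less_le_trans[OF _ div_le_dividend] simp del: mult_Suc)
    then have "card {k. k < x \<and> Suc k * y \<le> x} = x div y" by simp
    with False show ?thesis by (simp add: sum.If_cases of_bool_def Int_def del: mult_Suc)
  qed simp
  ultimately show ?thesis by simp
qed

lemma computable_mod:
  assumes "computable d f" "computable d g"
  shows "computable d (\<lambda>s. f s mod g s)"
  using computable_diff[OF assms(1) computable_mult[OF computable_div[OF assms] assms(2)]]
  by (simp add: minus_div_mult_eq_mod)

section \<open>The search machine\<close>

text \<open>The value may depend on register \<open>j\<close> itself, so it is computed in the
  scratch register \<open>d\<close> before \<open>j\<close> is overwritten.\<close>

lemma computable_assign:
  assumes "computable d f" "j < d"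
  obtains c where "\<And>s. (\<And>i. i \<ge> d \<Longrightarrow> s i = 0) \<Longrightarrow> runs c s (s(j := f s))"
proof -
  obtain c where c: "\<And>s. (\<And>i. i \<ge> d \<Longrightarrow> s i = 0) \<Longrightarrow> runs c s (s(d := f s))"
    using computable_runs[OF assms(1) order.refl] by blast
  have "runs (Seq c (Seq (clear_reg j) (move_reg d j))) s (s(j := f s))"
    if "\<And>i. i \<ge> d \<Longrightarrow> s i = 0" for s
    by (rule runs_Seq[OF c runs_Seq[OF runs_clear_reg[OF refl] runs_move_reg]])
      (use that assms in \<open>auto simp: fun_eq_iff\<close>)
  then show ?thesis using that by blast
qed

text \<open>Expressed by division and powers so that the closure lemmas apply;
  \<open>bit_at_eq_1_iff\<close> links it to \<open>bit\<close>.\<close>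

definition bit_at :: "nat \<Rightarrow> nat \<Rightarrow> nat" where
  "bit_at m q = m div 2 ^ q mod 2"

lemma bit_at_cases: "bit_at m q = 0 \<or> bit_at m q = 1"
  by (auto simp: bit_at_def)

lemma computable_bit_at:
  assumes "computable d f" "computable d g"
  shows "computable d (\<lambda>s. bit_at (f s) (g s))"
  unfolding bit_at_def
  by (intro computable_mod computable_div computable_power computable_const assms)

text \<open>Horner evaluation, most significant bit first. Started at 1, it distinguishes strings
  that differ only in leading zeros.\<close>

definition program_value :: "nat \<Rightarrow> bool list \<Rightarrow> nat" where
  "program_value = foldl (\<lambda>v b. 2 * v + of_bool b)"

text \<open>Halving removes the last binary digit, so the string is built up from its end and the
  leading 1 is left out.\<close>

lemma short_program:
  assumes "v \<ge> 1"
  shows "\<exists>p. program_value 1 p = v \<and> 2 ^ length p \<le> v"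
  using assms
proof (induction v rule: less_induct)
  case (less v)
  show ?case
  proof (cases "v = 1")
    case True
    then show ?thesis by (intro exI[of _ "[]"]) (simp add: program_value_def)
  next
    case False
    with less.prems have "v div 2 < v" "v div 2 \<ge> 1" by auto
    with less.IH obtain p where p: "program_value 1 p = v div 2" "2 ^ length p \<le> v div 2" by blast
    then show ?thesis
      by (intro exI[of _ "p @ [odd v]"]) (auto simp: program_value_def odd_iff_mod_2_eq_one)
  qed
qed

text \<open>\<open>Bit_Cond\<close> fails both at the separator and at the end of the input, so the
  same counting loop serves both blocks of ones.\<close>

lemma exec_read_pair:
  obtains c where "\<And>p n K. exec c (p, encode_pair n K, [], \<lambda>_. 0) (p, [], [], (\<lambda>_. 0)(0 := n, 1 := K))"
proof -
  define count where "count i = While Bit_Cond (Seq (Do Adv_Cond) (Do (Inc i)))" for i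
  have count: "exec (count i) (p, replicate l True @ z, x, s) (p, z, x, s(i := s i + l))"
    if "z = [] \<or> \<not> hd z" for i p l z x s
  proof -
    have "exec (Seq (Do Adv_Cond) (Do (Inc i))) (p, replicate (l - k) True @ z, x, s(i := s i + k))
        (p, replicate (l - Suc k) True @ z, x, s(i := s i + Suc k))" if "k < l" for k
    proof -
      have "l - k = Suc (l - Suc k)" using that by simp
      then show ?thesis
        using exec_Seq[OF exec_Do[of Adv_Cond] exec_Do[of "Inc i"],
            of "(p, replicate (l - k) True @ z, x, s(i := s i + k))"] by simp
    qed
    then show ?thesis
      using exec_While_iterate[where n = l and t = Bit_Cond and c = "Seq (Do Adv_Cond) (Do (Inc i))"
          and \<sigma> = "\<lambda>k. (p, replicate (l - k) True @ z, x, s(i := s i + k))"] that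
      unfolding count_def by simp
  qed
  have "exec (Seq (count 0) (Seq (Do Adv_Cond) (count 1))) (p, encode_pair n K, [], \<lambda>_. 0)
      (p, [], [], (\<lambda>_. 0)(0 := n, 1 := K))" for p n K
  proof (intro exec_Seq)
    show "exec (count 0) (p, encode_pair n K, [], \<lambda>_. 0) (p, [False] @ replicate K True, [], (\<lambda>_. 0)(0 := n))"
      using count[of "[False] @ replicate K True" 0 p n "[]" "\<lambda>_. 0"] by (simp add: encode_pair_def)
    show "exec (Do Adv_Cond) (p, [False] @ replicate K True, [], (\<lambda>_. 0)(0 := n))
        (p, replicate K True, [], (\<lambda>_. 0)(0 := n))"
      using exec_Do[of Adv_Cond "(p, [False] @ replicate K True, [], (\<lambda>_. 0)(0 := n))"] by simp
    show "exec (count 1) (p, replicate K True, [], (\<lambda>_. 0)(0 := n)) (p, [], [], (\<lambda>_. 0)(0 := n, 1 := K))"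
      using count[of "[]" 1 p K "[]" "(\<lambda>_. 0)(0 := n)"] by simp
  qed
  then show ?thesis using that by blast
qed

text \<open>The end of the program is recognised by the blank behind it, as plain complexity allows;
  no self-delimiting code is used.\<close>

lemma exec_read_program:
  obtains c where "\<And>p b x s. (\<And>i. i \<ge> 3 \<Longrightarrow> s i = 0) \<Longrightarrow>
    exec c (p, b, x, s) ([], b, x, s(2 := program_value (s 2) p))"
proof -
  have "computable 3 (\<lambda>s. 2 * s 2)" by (intro computable_mult computable_const computable_reg) simp
  then obtain c where c: "\<And>s. (\<And>i. i \<ge> 3 \<Longrightarrow> s i = 0) \<Longrightarrow> runs c s (s(2 := 2 * s 2))"
    by (rule computable_assign[where j = 2], simp, blast)
  define loop where "loop = Seq c (Seq (Cond Bit_Prog (Do (Inc 2)) Skip) (Do Adv_Prog))"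
  have "exec (While More_Prog loop) (p, b, x, s) ([], b, x, s(2 := program_value (s 2) p))"
    if "\<And>i. i \<ge> 3 \<Longrightarrow> s i = 0" for p b x s
    using that
  proof (induction p arbitrary: s)
    case Nil
    then show ?case by (auto simp: program_value_def intro: exec_WhileF)
  next
    case (Cons w p)
    define s' where "s' = s(2 := 2 * s 2 + of_bool w)"
    have "runs c s (s(2 := 2 * s 2))" by (intro c Cons.prems)
    then have 1: "exec c (w # p, b, x, s) (w # p, b, x, s(2 := 2 * s 2))" by (simp add: runs_def)
    have 2: "exec (Cond Bit_Prog (Do (Inc 2)) Skip) (w # p, b, x, s(2 := 2 * s 2)) (w # p, b, x, s')"
    proof (cases w)
      case True
      then show ?thesis
        using exec_Do[of "Inc 2" "(w # p, b, x, s(2 := 2 * s 2))"] by (intro exec_CondT) (auto simp: s'_def)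
    next
      case False
      then show ?thesis by (intro exec_CondF) (auto simp: s'_def intro: exec_Skip)
    qed
    have 3: "exec (Do Adv_Prog) (w # p, b, x, s') (p, b, x, s')"
      using exec_Do[of Adv_Prog "(w # p, b, x, s')"] by simp
    have "exec loop (w # p, b, x, s) (p, b, x, s')"
      unfolding loop_def by (intro exec_Seq[OF 1 exec_Seq[OF 2 3]])
    moreover have "exec (While More_Prog loop) (p, b, x, s') ([], b, x, s'(2 := program_value (s' 2) p))"
      using Cons.prems by (intro Cons.IH) (simp add: s'_def)
    ultimately have "exec (While More_Prog loop) (w # p, b, x, s) ([], b, x, s'(2 := program_value (s' 2) p))"
      by (rule exec_WhileT[rotated]) simp
    then show ?case by (simp only: s'_def program_value_def foldl.simps fun_upd_same fun_upd_upd)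
  qed
  then show ?thesis using that by blast
qed

text \<open>Register 2 counts the solutions still to be found, while register 3 runs through the
  candidates. The candidate is incremented after each test, so the search ends at
  \<open>Suc m\<close>.\<close>

lemma exec_search:
  assumes P: "computable 4 (\<lambda>s. of_bool (P (s 0) (s 1) (s 3)))"
  obtains c where "\<And>s m. (\<And>i. i \<ge> 3 \<Longrightarrow> s i = 0) \<Longrightarrow> P (s 0) (s 1) m \<Longrightarrow>
    s 2 = card {k. k \<le> m \<and> P (s 0) (s 1) k} \<Longrightarrow> runs c s (s(2 := 0, 3 := Suc m))"
proof -
  have "computable 4 (\<lambda>s. s 2 - of_bool (P (s 0) (s 1) (s 3)))"
    by (intro computable_diff P computable_reg) simp
  then obtain c where c: "\<And>s. (\<And>i. i \<ge> 4 \<Longrightarrow> s i = 0) \<Longrightarrow>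
      runs c s (s(2 := s 2 - of_bool (P (s 0) (s 1) (s 3))))"
    by (rule computable_assign[where j = 2], simp, blast)
  have "runs (While (Nonzero 2) (Seq c (Do (Inc 3)))) s (s(2 := 0, 3 := Suc m))"
    if s: "\<And>i. i \<ge> 3 \<Longrightarrow> s i = 0" and m: "P (s 0) (s 1) m"
      and v: "s 2 = card {k. k \<le> m \<and> P (s 0) (s 1) k}" for s m
  proof -
    define found where "found k = card {j. j < k \<and> P (s 0) (s 1) j}" for k
    define S where "S k = s(2 := s 2 - found k, 3 := k)" for k
    have found_Suc: "found (Suc k) = found k + of_bool (P (s 0) (s 1) k)" for k
    proof -
      have "{j. j < Suc k \<and> P (s 0) (s 1) j} =
          (if P (s 0) (s 1) k then insert k {j. j < k \<and> P (s 0) (s 1) j} else {j. j < k \<and> P (s 0) (s 1) j})"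
        by (auto simp: less_Suc_eq)
      then show ?thesis by (simp add: found_def)
    qed
    have v: "s 2 = found (Suc m)" using v by (simp add: found_def less_Suc_eq_le)
    show ?thesis
    proof (rule runs_While[where n = "Suc m" and S = S])
      \<comment> \<open>Before candidate \<open>m\<close> has been tested, the solution
        \<open>m\<close> itself is missing from \<open>found k\<close>.\<close>
      show "S k 2 \<noteq> 0" if "k < Suc m" for k
      proof -
        have "found k \<le> found m" unfolding found_def using that by (intro card_mono) auto
        then have "found k < s 2" using v found_Suc[of m] m by simp
        then show ?thesis by (simp add: S_def)
      qed
      show "runs (Seq c (Do (Inc 3))) (S k) (S (Suc k))" for k
        by (rule runs_Seq[OF c runs_Inc]) (use s in \<open>auto simp: S_def found_Suc fun_eq_iff\<close>)
      show "S (Suc m) 2 = 0" using v by (simp add: S_def)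
      show "s = S 0" using s by (simp add: S_def found_def fun_eq_iff)
      show "s(2 := 0, 3 := Suc m) = S (Suc m)" using v by (simp add: S_def fun_eq_iff)
    qed
  qed
  then show ?thesis using that by blast
qed

text \<open>Register 4 counts the remaining bits, 5 is the position and 6 holds the current bit.
  Register 3 exceeds the code by one, as the search leaves it.\<close>

lemma exec_write_bits:
  obtains c where "\<And>a b s m. (\<And>i. i \<ge> 4 \<Longrightarrow> s i = 0) \<Longrightarrow> s 3 = Suc m \<Longrightarrow>
    \<exists>s'. exec c (a, b, [], s) (a, b, map (\<lambda>q. bit_at m q = 1) [0..<s 1 * s 1], s')"
proof -
  have "computable 4 (\<lambda>s. s 1 * s 1)" by (intro computable_mult computable_reg) simp_all
  then obtain c1 where c1: "\<And>s. (\<And>i. i \<ge> 4 \<Longrightarrow> s i = 0) \<Longrightarrow> runs c1 s (s(4 := s 1 * s 1))"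
    using computable_runs[of 4 _ 4] by blast
  have "computable 6 (\<lambda>s. bit_at (s 3 - 1) (s 5))"
    by (intro computable_bit_at computable_pred computable_reg) simp_all
  then obtain c2 where c2: "\<And>s. (\<And>i. i \<ge> 6 \<Longrightarrow> s i = 0) \<Longrightarrow> runs c2 s (s(6 := bit_at (s 3 - 1) (s 5)))"
    using computable_runs[of 6 _ 6] by blast
  define emit where "emit = Cond (Nonzero 6) (Seq (Do (Dec 6)) (Do (Emit True))) (Do (Emit False))"
  define loop where "loop = Seq c2 (Seq emit (Seq (Do (Dec 4)) (Do (Inc 5))))"
  have emit: "exec emit (a, b, x, s(6 := bit_at m q)) (a, b, x @ [bit_at m q = 1], s)"
    if "s 6 = 0" for a b x s m q
  proof (cases "bit_at m q = 0")
    case True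
    then show ?thesis
      using that exec_Do[of "Emit False" "(a, b, x, s)"] unfolding emit_def
      by (intro exec_CondF) (auto simp: fun_upd_idem)
  next
    case False
    then have "bit_at m q = 1" using bit_at_cases[of m q] by simp
    then show ?thesis
      using that exec_Seq[OF exec_Do[of "Dec 6"] exec_Do[of "Emit True"], of "(a, b, x, s(6 := 1))"]
      unfolding emit_def by (intro exec_CondT) (auto simp: fun_upd_idem)
  qed
  have "\<exists>s'. exec (Seq c1 (While (Nonzero 4) loop)) (a, b, [], s)
      (a, b, map (\<lambda>q. bit_at m q = 1) [0..<s 1 * s 1], s')"
    if s: "\<And>i. i \<ge> 4 \<Longrightarrow> s i = 0" and m: "s 3 = Suc m" for a b s m
  proof -
    define Q where "Q = s 1 * s 1"
    define S where "S k = s(4 := Q - k, 5 := k)" for k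
    let ?\<sigma> = "\<lambda>k. (a, b, map (\<lambda>q. bit_at m q = 1) [0..<k], S k)"
    have step: "exec loop (?\<sigma> k) (?\<sigma> (Suc k))" for k
      unfolding loop_def
    proof (intro exec_Seq)
      have "S k 3 - 1 = m" "S k 5 = k" using m by (simp_all add: S_def)
      then show "exec c2 (?\<sigma> k) (a, b, map (\<lambda>q. bit_at m q = 1) [0..<k], (S k)(6 := bit_at m k))"
        using c2[of "S k"] s by (simp add: runs_def S_def)
      show "exec emit (a, b, map (\<lambda>q. bit_at m q = 1) [0..<k], (S k)(6 := bit_at m k))
          (a, b, map (\<lambda>q. bit_at m q = 1) [0..<k] @ [bit_at m k = 1], S k)"
        using s by (intro emit) (simp add: S_def)
      show "exec (Do (Dec 4)) (a, b, map (\<lambda>q. bit_at m q = 1) [0..<k] @ [bit_at m k = 1], S k)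
          (a, b, map (\<lambda>q. bit_at m q = 1) [0..<Suc k], (S k)(4 := Q - Suc k))"
        using exec_Do[of "Dec 4" "(a, b, map (\<lambda>q. bit_at m q = 1) [0..<Suc k], S k)"]
        by (simp add: S_def fun_upd_twist)
      show "exec (Do (Inc 5)) (a, b, map (\<lambda>q. bit_at m q = 1) [0..<Suc k], (S k)(4 := Q - Suc k))
          (?\<sigma> (Suc k))"
        using exec_Do[of "Inc 5" "(a, b, map (\<lambda>q. bit_at m q = 1) [0..<Suc k], (S k)(4 := Q - Suc k))"]
        by (simp add: S_def fun_upd_twist)
    qed
    have "exec (While (Nonzero 4) loop) (?\<sigma> 0) (?\<sigma> Q)"
      by (rule exec_While_iterate[where \<sigma> = ?\<sigma>, OF _ step]) (simp_all add: S_def)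
    moreover have "s(4 := Q) = S 0" using s by (simp add: S_def fun_eq_iff)
    then have "exec c1 (a, b, [], s) (?\<sigma> 0)" using c1[of s] s by (simp add: runs_def Q_def)
    ultimately show ?thesis unfolding Q_def by (blast intro: exec_Seq)
  qed
  then show ?thesis using that by blast
qed

text \<open>
  A program of length \<open>l\<close> is read as the number with binary expansion \<open>1p\<close>, so the first \<open>2\<^sup>l\<close>
  solutions of a computable predicate have programs of length at most \<open>l\<close>.
\<close>

lemma search_machine:
  assumes P: "computable 4 (\<lambda>s. of_bool (P (s 0) (s 1) (s 3)))"
  obtains T where "turing_machine T"
    "\<And>n K m. P n K m \<Longrightarrow> \<exists>p. 2 ^ length p \<le> card {k. k \<le> m \<and> P n K k} \<and>
       tm_outputs T p (encode_pair n K) (map (\<lambda>q. bit_at m q = 1) [0..<K * K])"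
proof -
  obtain c1 where c1: "\<And>p n K. exec c1 (p, encode_pair n K, [], \<lambda>_. 0) (p, [], [], (\<lambda>_. 0)(0 := n, 1 := K))"
    using exec_read_pair by blast
  obtain c2 where c2: "\<And>p b x s. (\<And>i. i \<ge> 3 \<Longrightarrow> s i = 0) \<Longrightarrow>
      exec c2 (p, b, x, s) ([], b, x, s(2 := program_value (s 2) p))"
    using exec_read_program by blast
  obtain c3 where c3: "\<And>s m. (\<And>i. i \<ge> 3 \<Longrightarrow> s i = 0) \<Longrightarrow> P (s 0) (s 1) m \<Longrightarrow>
      s 2 = card {k. k \<le> m \<and> P (s 0) (s 1) k} \<Longrightarrow> runs c3 s (s(2 := 0, 3 := Suc m))"
    using exec_search[OF P] by blast
  obtain c4 where c4: "\<And>a b s m. (\<And>i. i \<ge> 4 \<Longrightarrow> s i = 0) \<Longrightarrow> s 3 = Suc m \<Longrightarrow>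
      \<exists>s'. exec c4 (a, b, [], s) (a, b, map (\<lambda>q. bit_at m q = 1) [0..<s 1 * s 1], s')"
    using exec_write_bits by blast
  \<comment> \<open>\<open>Do (Inc 2)\<close> supplies the leading digit 1 of the number read from
    the program.\<close>
  define c where "c = Seq c1 (Seq (Do (Inc 2)) (Seq c2 (Seq c3 c4)))"
  obtain T where T: "turing_machine T"
    "\<And>p y a b x s. exec c (p, y, [], \<lambda>_. 0) (a, b, x, s) \<Longrightarrow> tm_outputs T p y x"
    using exec_imp_tm_outputs by blast
  have "\<exists>p. 2 ^ length p \<le> card {k. k \<le> m \<and> P n K k} \<and>
      tm_outputs T p (encode_pair n K) (map (\<lambda>q. bit_at m q = 1) [0..<K * K])" if m: "P n K m" for n K m
  proof -
    define v where "v = card {k. k \<le> m \<and> P n K k}"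
    have "v \<ge> 1" unfolding v_def using m by (auto simp: Suc_le_eq card_gt_0_iff)
    with short_program obtain p where p: "program_value 1 p = v" "2 ^ length p \<le> v" by blast
    define s where "s = (\<lambda>_::nat. 0 :: nat)(0 := n, 1 := K)"
    have e2: "exec (Do (Inc 2)) (p, [], [], s) (p, [], [], s(2 := 1))"
      using exec_Do[of "Inc 2" "(p, [], [], s)"] by (simp add: s_def)
    have e3: "exec c2 (p, [], [], s(2 := 1)) ([], [], [], s(2 := v))"
      using c2[of "s(2 := 1)" p "[]" "[]"] p by (simp add: s_def)
    have "runs c3 (s(2 := v)) (s(2 := 0, 3 := Suc m))"
      using c3[of "s(2 := v)" m] m by (simp add: s_def v_def)
    then have e4: "exec c3 ([], [], [], s(2 := v)) ([], [], [], s(2 := 0, 3 := Suc m))"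
      by (simp add: runs_def)
    obtain s' where e5: "exec c4 ([], [], [], s(2 := 0, 3 := Suc m))
        ([], [], map (\<lambda>q. bit_at m q = 1) [0..<K * K], s')"
      using c4[of "s(2 := 0, 3 := Suc m)" m "[]" "[]"] by (auto simp: s_def)
    have "exec c (p, encode_pair n K, [], \<lambda>_. 0) ([], [], map (\<lambda>q. bit_at m q = 1) [0..<K * K], s')"
      unfolding c_def using c1[of p n K] e2 e3 e4 e5 unfolding s_def by (blast intro: exec_Seq)
    then show ?thesis using T(2) p(2) unfolding v_def by blast
  qed
  with T(1) that show ?thesis by blast
qed

section \<open>Counting flat triples of grid points\<close>

text \<open>The least and the greatest solution \<open>t\<close> differ by at most
  \<open>2 * a / \<bar>u\<bar>\<close>. Multiplying by \<open>\<bar>u\<bar>\<close> keeps the bound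
  in the integers.\<close>

lemma card_strip_le:
  fixes u w a :: int
  assumes "finite I" "u \<noteq> 0" "a \<ge> 0"
  shows "\<bar>u\<bar> * int (card {t \<in> I. \<bar>u * t - w\<bar> \<le> a}) \<le> 2 * a + \<bar>u\<bar>"
proof (cases "{t \<in> I. \<bar>u * t - w\<bar> \<le> a} = {}")
  case True
  show ?thesis unfolding True using assms by simp
next
  case False
  define D where "D = {t \<in> I. \<bar>u * t - w\<bar> \<le> a}"
  have D: "finite D" "D \<noteq> {}" using assms False by (auto simp: D_def)
  have "Max D \<in> D" "Min D \<in> D" "Min D \<le> Max D" using D by auto
  then have "\<bar>u * Max D - u * Min D\<bar> \<le> 2 * a" unfolding D_def by auto
  then have "\<bar>u\<bar> * (Max D - Min D) \<le> 2 * a"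
    using \<open>Min D \<le> Max D\<close> by (simp add: abs_mult flip: right_diff_distrib)
  moreover have "card D \<le> card {Min D..Max D}" using D by (intro card_mono) auto
  then have "int (card D) \<le> Max D - Min D + 1" using \<open>Min D \<le> Max D\<close> by simp
  then have "\<bar>u\<bar> * int (card D) \<le> \<bar>u\<bar> * (Max D - Min D + 1)" by (intro mult_left_mono) auto
  ultimately show ?thesis unfolding D_def by (simp add: distrib_left)
qed

lemma card_strips_le:
  fixes u a :: int and w :: "int \<Rightarrow> int"
  assumes "finite I" "u \<noteq> 0" "a \<ge> 0"
  shows "\<bar>u\<bar> * int (card {(x, t) \<in> I \<times> I. \<bar>u * t - w x\<bar> \<le> a}) \<le> int (card I) * (2 * a + \<bar>u\<bar>)"
proof -
  have eq: "{(x, t) \<in> I \<times> I. \<bar>u * t - w x\<bar> \<le> a} = (SIGMA x:I. {t \<in> I. \<bar>u * t - w x\<bar> \<le> a})" by auto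
  have "\<bar>u\<bar> * int (card {(x, t) \<in> I \<times> I. \<bar>u * t - w x\<bar> \<le> a}) =
      (\<Sum>x\<in>I. \<bar>u\<bar> * int (card {t \<in> I. \<bar>u * t - w x\<bar> \<le> a}))"
    using assms(1) unfolding eq by (simp add: card_SigmaI sum_distrib_left)
  also have "\<dots> \<le> (\<Sum>x\<in>I. 2 * a + \<bar>u\<bar>)" by (intro sum_mono card_strip_le assms)
  finally show ?thesis by simp
qed

text \<open>The determinant of \<open>Q - P\<close> and \<open>R - P\<close>, that is, twice the
  signed area of the triangle.\<close>

definition cross :: "int \<times> int \<Rightarrow> int \<times> int \<Rightarrow> int \<times> int \<Rightarrow> int" where
  "cross P Q R = (fst Q - fst P) * (snd R - snd P) - (fst R - fst P) * (snd Q - snd P)"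

definition sup_dist :: "int \<times> int \<Rightarrow> int \<times> int \<Rightarrow> int" where
  "sup_dist P Q = max \<bar>fst Q - fst P\<bar> \<bar>snd Q - snd P\<bar>"

text \<open>With one coordinate of \<open>R\<close> fixed, \<open>cross\<close> is affine in the
  other. Solving for the coordinate with the larger coefficient makes the modulus of that
  coefficient the sup-distance; the second case swaps the coordinates.\<close>

lemma card_near_line_le:
  fixes P Q :: "int \<times> int"
  assumes "finite I" "P \<noteq> Q" "a \<ge> 0"
  shows "sup_dist P Q * int (card {R \<in> I \<times> I. \<bar>cross P Q R\<bar> \<le> a}) \<le> int (card I) * (2 * a + sup_dist P Q)"
proof -
  define u v where "u = fst Q - fst P" and "v = snd Q - snd P"
  have uv: "u \<noteq> 0 \<or> v \<noteq> 0" using assms(2) by (auto simp: u_def v_def prod_eq_iff)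
  show ?thesis
  proof (cases "\<bar>v\<bar> \<le> \<bar>u\<bar>")
    case True
    have "{R \<in> I \<times> I. \<bar>cross P Q R\<bar> \<le> a} =
        {(x, t) \<in> I \<times> I. \<bar>u * t - (u * snd P + v * (x - fst P))\<bar> \<le> a}"
      by (auto simp: cross_def u_def v_def algebra_simps)
    moreover have "sup_dist P Q = \<bar>u\<bar>" using True by (simp add: sup_dist_def u_def v_def)
    ultimately show ?thesis
      using card_strips_le[OF assms(1) _ assms(3), of u "\<lambda>x. u * snd P + v * (x - fst P)"] uv True by auto
  next
    case False
    have "{R \<in> I \<times> I. \<bar>cross P Q R\<bar> \<le> a} =
        prod.swap ` {(x, t) \<in> I \<times> I. \<bar>v * t - (v * fst P + u * (x - snd P))\<bar> \<le> a}"
      by (force simp: cross_def u_def v_def algebra_simps image_iff)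
    then have "card {R \<in> I \<times> I. \<bar>cross P Q R\<bar> \<le> a} =
        card {(x, t) \<in> I \<times> I. \<bar>v * t - (v * fst P + u * (x - snd P))\<bar> \<le> a}"
      by (simp add: card_image)
    moreover have "sup_dist P Q = \<bar>v\<bar>" using False by (simp add: sup_dist_def u_def v_def)
    ultimately show ?thesis
      using card_strips_le[OF assms(1) _ assms(3), of v "\<lambda>x. v * fst P + u * (x - snd P)"] False by auto
  qed
qed

text \<open>The sphere is the boundary of a square, covered by four sides of
  \<open>2 * r + 1\<close> points each, and \<open>2 * r + 1 \<le> 3 * r\<close>.\<close>

lemma card_sphere_le:
  assumes "r \<ge> 1"
  shows "finite {Q. sup_dist P Q = r}" "int (card {Q. sup_dist P Q = r}) \<le> 12 * r"
proof -
  obtain x y where P: "P = (x, y)" by fastforce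
  define S where "S = {x - r, x + r} \<times> {y - r..y + r} \<union> {x - r..x + r} \<times> {y - r, y + r}"
  have sub: "{Q. sup_dist P Q = r} \<subseteq> S" 
    by (auto simp: S_def sup_dist_def P max_def split: if_splits)
  have S: "finite S" by (simp add: S_def)
  then show "finite {Q. sup_dist P Q = r}" using sub finite_subset by blast
  have "card {Q. sup_dist P Q = r} \<le> card S" using S sub by (rule card_mono)
  also have "\<dots> \<le> card ({x - r, x + r} \<times> {y - r..y + r}) + card ({x - r..x + r} \<times> {y - r, y + r})"
    unfolding S_def by (rule card_Un_le)
  also have "\<dots> = 4 * nat (2 * r + 1)" using assms by (simp add: card_cartesian_product)
  finally show "int (card {Q. sup_dist P Q = r}) \<le> 12 * r" using assms by linarith
qed

text \<open>The points \<open>Q\<close> are grouped by their sup-distance \<open>r\<close> from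
  \<open>P\<close>. The factor \<open>r\<close> in the size of the sphere cancels the one in
  \<open>card_near_line_le\<close>, which leaves a bound independent of \<open>r\<close> for each of
  the fewer than \<open>K\<close> distances.\<close>

lemma card_flat_pairs_le:
  fixes K :: nat and a :: int and P :: "int \<times> int"
  defines "I \<equiv> {0..<int K}"
  assumes "P \<in> I \<times> I" "a \<ge> 0"
  shows "int (card {(Q, R). Q \<in> I \<times> I \<and> R \<in> I \<times> I \<and> P \<noteq> Q \<and> \<bar>cross P Q R\<bar> \<le> a})
    \<le> 12 * int K ^ 2 * (2 * a + int K)"
proof -
  define line where "line Q = {R \<in> I \<times> I. \<bar>cross P Q R\<bar> \<le> a}" for Q
  define sphere where "sphere r = {Q. sup_dist P Q = r}" for r
  have fin: "finite (line Q)" for Q by (simp add: line_def I_def)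
  have ring: "int (card (SIGMA Q:sphere r. line Q)) \<le> 12 * int K * (2 * a + int K)"
    if r: "r \<in> {1..<int K}" for r
  proof -
    have fs: "finite (sphere r)" and cs: "int (card (sphere r)) \<le> 12 * r"
      using card_sphere_le[of r P] r by (auto simp: sphere_def)
    have "r * int (card (SIGMA Q:sphere r. line Q)) = (\<Sum>Q\<in>sphere r. r * int (card (line Q)))"
      using fs fin by (simp add: card_SigmaI sum_distrib_left)
    also have "\<dots> \<le> (\<Sum>Q\<in>sphere r. int K * (2 * a + r))"
    proof (rule sum_mono)
      fix Q assume "Q \<in> sphere r"
      then have "sup_dist P Q = r" "P \<noteq> Q" using r by (auto simp: sphere_def sup_dist_def)
      then show "r * int (card (line Q)) \<le> int K * (2 * a + r)"
        using card_near_line_le[of I P Q a] assms(3) by (simp add: line_def I_def)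
    qed
    also have "\<dots> = int (card (sphere r)) * (int K * (2 * a + r))" by simp
    also have "\<dots> \<le> (12 * r) * (int K * (2 * a + r))"
      using cs r assms(3) by (intro mult_right_mono) auto
    also have "\<dots> \<le> r * (12 * int K * (2 * a + int K))"
      using r by (simp add: mult_left_mono)
    finally show ?thesis using r by simp
  qed
  have sub: "{(Q, R). Q \<in> I \<times> I \<and> R \<in> I \<times> I \<and> P \<noteq> Q \<and> \<bar>cross P Q R\<bar> \<le> a}
      \<subseteq> (\<Union>r\<in>{1..<int K}. SIGMA Q:sphere r. line Q)"
    using assms(2) by (auto simp: sphere_def line_def sup_dist_def I_def prod_eq_iff)
  have "card {(Q, R). Q \<in> I \<times> I \<and> R \<in> I \<times> I \<and> P \<noteq> Q \<and> \<bar>cross P Q R\<bar> \<le> a}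
      \<le> card (\<Union>r\<in>{1..<int K}. SIGMA Q:sphere r. line Q)"
    using sub by (intro card_mono finite_UN_I finite_SigmaI fin) (auto simp: sphere_def card_sphere_le)
  also have "\<dots> \<le> (\<Sum>r\<in>{1..<int K}. card (SIGMA Q:sphere r. line Q))"
    by (rule card_UN_le) simp
  finally have "int (card {(Q, R). Q \<in> I \<times> I \<and> R \<in> I \<times> I \<and> P \<noteq> Q \<and> \<bar>cross P Q R\<bar> \<le> a})
      \<le> (\<Sum>r\<in>{1..<int K}. int (card (SIGMA Q:sphere r. line Q)))"
    by (simp flip: of_nat_sum)
  also have "\<dots> \<le> (\<Sum>r\<in>{1..<int K}. 12 * int K * (2 * a + int K))" by (intro sum_mono ring)
  also have "\<dots> = int (K - 1) * (12 * int K * (2 * a + int K))" by (simp add: nat_diff_distrib)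
  also have "\<dots> \<le> int K * (12 * int K * (2 * a + int K))"
    using assms(3) by (intro mult_right_mono) auto
  finally show ?thesis by (simp add: power2_eq_square mult_ac)
qed

lemma card_flat_triples_le:
  fixes K :: nat and a :: int
  defines "I \<equiv> {0..<int K}"
  assumes "a \<ge> 0"
  shows "int (card {(P, Q, R). P \<in> I \<times> I \<and> Q \<in> I \<times> I \<and> R \<in> I \<times> I \<and> P \<noteq> Q \<and> \<bar>cross P Q R\<bar> \<le> a})
    \<le> 12 * int K ^ 4 * (2 * a + int K)"
proof -
  define F where "F P = {(Q, R). Q \<in> I \<times> I \<and> R \<in> I \<times> I \<and> P \<noteq> Q \<and> \<bar>cross P Q R\<bar> \<le> a}" for P
  have fin: "finite (F P)" for P
    by (rule finite_subset[of _ "(I \<times> I) \<times> (I \<times> I)"]) (auto simp: F_def I_def)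
  have "{(P, Q, R). P \<in> I \<times> I \<and> Q \<in> I \<times> I \<and> R \<in> I \<times> I \<and> P \<noteq> Q \<and> \<bar>cross P Q R\<bar> \<le> a} = Sigma (I \<times> I) F"
    by (auto simp: F_def)
  then have "int (card {(P, Q, R). P \<in> I \<times> I \<and> Q \<in> I \<times> I \<and> R \<in> I \<times> I \<and> P \<noteq> Q \<and> \<bar>cross P Q R\<bar> \<le> a}) =
      (\<Sum>P\<in>I \<times> I. int (card (F P)))"
    using fin by (simp add: I_def)
  also have "\<dots> \<le> (\<Sum>P\<in>I \<times> I. 12 * int K ^ 2 * (2 * a + int K))"
    using card_flat_pairs_le[of _ K a] assms(2) by (intro sum_mono) (auto simp: F_def I_def)
  also have "\<dots> = 12 * int K ^ 4 * (2 * a + int K)"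
    by (simp add: I_def card_cartesian_product power4_eq_xxxx power2_eq_square)
  finally show ?thesis .
qed

section \<open>Codes of arrangements with a distinguished triangle\<close>

text \<open>The indexing of grid points used by \<open>encode_arrangement\<close>.\<close>

definition grid_pos :: "nat \<Rightarrow> nat \<Rightarrow> int \<times> int" where
  "grid_pos K A = (int (A div K), int (A mod K))"

text \<open>Twice the area of the triangle with the given grid points, in units of the grid cell.\<close>

definition double_area :: "nat \<Rightarrow> nat \<Rightarrow> nat \<Rightarrow> nat \<Rightarrow> nat" where
  "double_area K A B C = nat \<bar>cross (grid_pos K A) (grid_pos K B) (grid_pos K C)\<bar>"

text \<open>The shoelace formula with its positive and negative terms collected; the two truncated
  differences add up to the absolute value. This form uses only operations already known to be
  computable.\<close>

lemma double_area_eq_diff: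
  "double_area K A B C =
    ((A div K) * (B mod K) + (B div K) * (C mod K) + (C div K) * (A mod K)
      - ((A div K) * (C mod K) + (B div K) * (A mod K) + (C div K) * (B mod K))) +
    ((A div K) * (C mod K) + (B div K) * (A mod K) + (C div K) * (B mod K)
      - ((A div K) * (B mod K) + (B div K) * (C mod K) + (C div K) * (A mod K)))"
proof -
  have abs_diff: "nat \<bar>int p - int q\<bar> = (p - q) + (q - p)" for p q :: nat by auto
  have "cross (grid_pos K A) (grid_pos K B) (grid_pos K C) =
    int ((A div K) * (B mod K) + (B div K) * (C mod K) + (C div K) * (A mod K)) -
    int ((A div K) * (C mod K) + (B div K) * (A mod K) + (C div K) * (B mod K))"
    unfolding cross_def grid_pos_def fst_conv snd_conv of_nat_add of_nat_mult
    by (simp add: algebra_simps)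
  then show ?thesis unfolding double_area_def by (simp only: abs_diff)
qed

lemma computable_double_area:
  assumes "computable d k" "computable d f" "computable d g" "computable d h"
  shows "computable d (\<lambda>s. double_area (k s) (f s) (g s) (h s))"
  unfolding double_area_eq_diff
  by (intro computable_add computable_diff computable_mult computable_div computable_mod assms)

definition code_vertex :: "nat \<Rightarrow> nat \<Rightarrow> nat \<Rightarrow> nat" where
  "code_vertex K i m = m div 2 ^ (K * K) div (K * K) ^ i mod (K * K)"

definition code_area :: "nat \<Rightarrow> nat \<Rightarrow> nat" where
  "code_area K m = m div 2 ^ (K * K) div (K * K) ^ 3"

text \<open>
  The number \<open>m = N + 2\<^sup>Q (A + Q (B + Q (C + Q a)))\<close> with \<open>Q = K\<^sup>2\<close> codes the arrangement with
  characteristic bits \<open>N\<close> together with three of its pebbles and the double area \<open>a\<close> of their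
  triangle. As \<open>a\<close> is the leading digit, codes are ordered by area.
\<close>

definition triangle_code :: "nat \<Rightarrow> nat \<Rightarrow> nat \<Rightarrow> bool" where
  "triangle_code n K m \<longleftrightarrow>
     code_vertex K 0 m < code_vertex K 1 m \<and> code_vertex K 1 m < code_vertex K 2 m \<and>
     bit_at m (code_vertex K 0 m) = 1 \<and> bit_at m (code_vertex K 1 m) = 1 \<and>
     bit_at m (code_vertex K 2 m) = 1 \<and> (\<Sum>q<K * K. bit_at m q) = n \<and>
     double_area K (code_vertex K 0 m) (code_vertex K 1 m) (code_vertex K 2 m) = code_area K m"

lemma computable_code_vertex:
  assumes "computable d k" "computable d f"
  shows "computable d (\<lambda>s. code_vertex (k s) i (f s))"
  unfolding code_vertex_def
  by (intro computable_mod computable_div computable_power computable_mult computable_const assms)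

lemma computable_triangle_code: "computable 4 (\<lambda>s. of_bool (triangle_code (s 0) (s 1) (s 3)))"
proof -
  have reg: "computable 4 (\<lambda>s. s 0)" "computable 4 (\<lambda>s. s 1)" "computable 4 (\<lambda>s. s 3)"
    by (auto intro: computable_reg)
  have "computable 4 (\<lambda>s. \<Sum>q<s 1 * s 1. bit_at (s 3) q)"
    by (rule computable_sum[where h = "\<lambda>x y k. bit_at x k" and g = "\<lambda>s. 0"])
      (intro reg computable_mult computable_0 computable_bit_at | assumption)+
  moreover have "computable 4 (\<lambda>s. code_area (s 1) (s 3))"
    unfolding code_area_def
    by (intro computable_div computable_power computable_mult computable_const reg)
  ultimately show ?thesis
    unfolding triangle_code_def
    by (intro computable_conj computable_less computable_eq computable_bit_at computable_const
        computable_code_vertex computable_double_area reg)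
qed

section \<open>Binary and mixed-radix digits of codes\<close>

lemma bit_at_eq_1_iff: "bit_at m q = 1 \<longleftrightarrow> bit m q"
  by (simp add: bit_at_def bit_iff_odd odd_iff_mod_2_eq_one)

lemma sum_bit_at: "(\<Sum>q<Q. bit_at m q) = card {q. q < Q \<and> bit m q}"
proof -
  have "bit_at m q = of_bool (bit m q)" for q
    using bit_at_cases[of m q] bit_at_eq_1_iff[of m q] by auto
  then show ?thesis by (simp add: of_bool_def sum.If_cases Int_def)
qed

lemma mod_power_2_eqI:
  fixes k l :: nat
  assumes "\<And>q. q < Q \<Longrightarrow> bit k q = bit l q"
  shows "k mod 2 ^ Q = l mod 2 ^ Q"
proof -
  have "take_bit Q k = take_bit Q l" using assms by (intro bit_eqI) (auto simp: bit_take_bit_iff)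
  then show ?thesis by (simp add: take_bit_eq_mod)
qed

lemma code_area_mono: "k \<le> m \<Longrightarrow> code_area K k \<le> code_area K m"
  unfolding code_area_def by (intro div_le_mono)

text \<open>Recovers a code from its characteristic bits, vertices and area, which gives the
  injectivity in \<open>card_triangle_codes_le\<close>.\<close>

lemma code_digits:
  fixes m K :: nat
  defines "Q \<equiv> K * K"
  shows "m = m mod 2 ^ Q + 2 ^ Q * (code_vertex K 0 m + Q * (code_vertex K 1 m +
    Q * (code_vertex K 2 m + Q * code_area K m)))"
proof -
  have "w = w mod Q + Q * (w div Q mod Q + Q * (w div Q ^ 2 mod Q + Q * (w div Q ^ 3)))" for w
  proof -
    have "w div Q ^ 2 = w div Q div Q" "w div Q ^ 3 = w div Q div Q div Q"
      by (simp_all add: div_mult2_eq power2_eq_square power3_eq_cube)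
    then show ?thesis by simp
  qed
  from this[of "m div 2 ^ Q"] show ?thesis
    by (simp add: code_vertex_def code_area_def flip: Q_def)
qed

text \<open>Removing \<open>T\<close> is injective on the supersets of \<open>T\<close>.\<close>

lemma card_supersets_le:
  assumes "finite X" "T \<subseteq> X"
  shows "card {S. S \<subseteq> X \<and> card S = n \<and> T \<subseteq> S} \<le> (card X - card T) choose (n - card T)"
proof -
  have finT: "finite T" using assms finite_subset by blast
  have "card {S. S \<subseteq> X \<and> card S = n \<and> T \<subseteq> S} \<le> card {S. S \<subseteq> X - T \<and> card S = n - card T}"
  proof (rule card_inj_on_le[where f = "\<lambda>S. S - T"])
    show "inj_on (\<lambda>S. S - T) {S. S \<subseteq> X \<and> card S = n \<and> T \<subseteq> S}"
      by (rule inj_onI) blast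
    show "(\<lambda>S. S - T) ` {S. S \<subseteq> X \<and> card S = n \<and> T \<subseteq> S} \<subseteq> {S. S \<subseteq> X - T \<and> card S = n - card T}"
      using finT by (auto simp: card_Diff_subset)
  qed (use assms in simp)
  also have "\<dots> = card (X - T) choose (n - card T)" using assms by (intro n_subsets) simp
  also have "card (X - T) = card X - card T" using assms finT by (simp add: card_Diff_subset)
  finally show ?thesis .
qed

lemma inj_grid_pos: "inj (grid_pos K)"
  by (rule injI) (metis grid_pos_def div_mult_mod_eq of_nat_eq_iff prod.inject)

text \<open>The count of point triples carries over by injectivity of \<open>grid_pos\<close>;
  \<open>A < B\<close> makes the first two points distinct.\<close>

lemma card_flat_index_triples_le:
  "card {(A, B, C). A < B \<and> B < C \<and> C < K * K \<and> double_area K A B C \<le> a}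
    \<le> 12 * K ^ 4 * (2 * a + K)"
proof -
  let ?I = "{0..<int K}"
  let ?T = "{(P, Q, R). P \<in> ?I \<times> ?I \<and> Q \<in> ?I \<times> ?I \<and> R \<in> ?I \<times> ?I \<and> P \<noteq> Q \<and> \<bar>cross P Q R\<bar> \<le> int a}"
  have pos: "grid_pos K A \<in> ?I \<times> ?I" if "A < K * K" for A
  proof -
    have "K > 0" using that by (cases K) auto
    then show ?thesis using that by (simp add: grid_pos_def less_mult_imp_div_less)
  qed
  have "card {(A, B, C). A < B \<and> B < C \<and> C < K * K \<and> double_area K A B C \<le> a} \<le> card ?T"
  proof (rule card_inj_on_le[where f = "map_prod (grid_pos K) (map_prod (grid_pos K) (grid_pos K))"])
    show "inj_on (map_prod (grid_pos K) (map_prod (grid_pos K) (grid_pos K)))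
        {(A, B, C). A < B \<and> B < C \<and> C < K * K \<and> double_area K A B C \<le> a}"
      using prod.inj_map[OF inj_grid_pos prod.inj_map[OF inj_grid_pos inj_grid_pos]] subset_UNIV
      by (rule inj_on_subset)
    show "map_prod (grid_pos K) (map_prod (grid_pos K) (grid_pos K)) `
        {(A, B, C). A < B \<and> B < C \<and> C < K * K \<and> double_area K A B C \<le> a} \<subseteq> ?T"
    proof (rule image_subsetI)
      fix t assume "t \<in> {(A, B, C). A < B \<and> B < C \<and> C < K * K \<and> double_area K A B C \<le> a}"
      then obtain A B C where t: "t = (A, B, C)"
        and *: "A < B" "B < C" "C < K * K" "double_area K A B C \<le> a" by auto
      have "grid_pos K A \<noteq> grid_pos K B" using inj_grid_pos *(1) by (metis injD less_irrefl)
      moreover have "\<bar>cross (grid_pos K A) (grid_pos K B) (grid_pos K C)\<bar> \<le> int a"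
        using *(4) by (simp add: double_area_def nat_le_iff)
      ultimately have "(grid_pos K A, grid_pos K B, grid_pos K C) \<in> ?T"
        using * pos[of A] pos[of B] pos[of C] by simp
      then show "map_prod (grid_pos K) (map_prod (grid_pos K) (grid_pos K)) t \<in> ?T"
        by (simp add: t)
    qed
    show "finite ?T"
      by (rule finite_subset[of _ "(?I \<times> ?I) \<times> (?I \<times> ?I) \<times> (?I \<times> ?I)"]) auto
  qed
  moreover have "int (card ?T) \<le> int (12 * K ^ 4 * (2 * a + K))"
    using card_flat_triples_le[of "int a" K] by simp
  ultimately show ?thesis by linarith
qed

text \<open>As the area is the leading digit, codes up to \<open>m\<close> have area at most
  \<open>code_area K m\<close>. The vertices determine the area, so a code is given by a flat triple
  and a set of size \<open>n\<close> containing it.\<close>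

lemma card_triangle_codes_le:
  "card {k. k \<le> m \<and> triangle_code n K k}
    \<le> 12 * K ^ 4 * (2 * code_area K m + K) * ((K * K - 3) choose (n - 3))"
proof -
  define Q where "Q = K * K"
  define a where "a = code_area K m"
  define Tr where "Tr = {(A, B, C). A < B \<and> B < C \<and> C < Q \<and> double_area K A B C \<le> a}"
  define F where "F = (\<lambda>(A, B, C). {S. S \<subseteq> {..<Q} \<and> card S = n \<and> {A, B, C} \<subseteq> S})"
  define f where "f k = ((code_vertex K 0 k, code_vertex K 1 k, code_vertex K 2 k), {q. q < Q \<and> bit k q})" for k
  have fin: "finite Tr"
    by (rule finite_subset[of _ "{..<Q} \<times> {..<Q} \<times> {..<Q}"]) (auto simp: Tr_def)
  have finF: "finite (F t)" for t
    by (cases t) (auto simp: F_def intro: finite_subset[of _ "Pow {..<Q}"])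
  have "card {k. k \<le> m \<and> triangle_code n K k} \<le> card (Sigma Tr F)"
  proof (rule card_inj_on_le[where f = f])
    show "inj_on f {k. k \<le> m \<and> triangle_code n K k}"
    proof (rule inj_onI)
      fix k l assume kl: "k \<in> {k. k \<le> m \<and> triangle_code n K k}" "l \<in> {k. k \<le> m \<and> triangle_code n K k}"
        and eq: "f k = f l"
      have v: "code_vertex K 0 k = code_vertex K 0 l" "code_vertex K 1 k = code_vertex K 1 l"
        "code_vertex K 2 k = code_vertex K 2 l" using eq by (auto simp: f_def)
      moreover have "code_area K k = code_area K l" using kl v by (auto simp: triangle_code_def)
      moreover have "k mod 2 ^ Q = l mod 2 ^ Q" using eq by (intro mod_power_2_eqI) (auto simp: f_def)
      ultimately show "k = l" using code_digits[of k K] code_digits[of l K] by (simp add: Q_def)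
    qed
    show "f ` {k. k \<le> m \<and> triangle_code n K k} \<subseteq> Sigma Tr F"
    proof (rule image_subsetI)
      fix k assume "k \<in> {k. k \<le> m \<and> triangle_code n K k}"
      then have k: "k \<le> m" "triangle_code n K k" by auto
      \<comment> \<open>For \<open>K = 0\<close>, division by zero makes the second vertex 0, which
        cannot exceed the first.\<close>
      have "Q > 0" using k(2) by (cases "K = 0") (auto simp: triangle_code_def code_vertex_def Q_def)
      then have lt: "code_vertex K i k < Q" for i by (simp add: code_vertex_def Q_def)
      have "(code_vertex K 0 k, code_vertex K 1 k, code_vertex K 2 k) \<in> Tr"
        using k lt code_area_mono[OF k(1), of K] by (simp add: Tr_def triangle_code_def a_def)
      moreover have "{q. q < Q \<and> bit k q} \<in> F (code_vertex K 0 k, code_vertex K 1 k, code_vertex K 2 k)"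
        using k(2) lt unfolding triangle_code_def bit_at_eq_1_iff sum_bit_at
        by (auto simp: F_def Q_def)
      ultimately show "f k \<in> Sigma Tr F" by (simp add: f_def)
    qed
    show "finite (Sigma Tr F)" using fin finF by (rule finite_SigmaI)
  qed
  also have "card (Sigma Tr F) = (\<Sum>t\<in>Tr. card (F t))" using fin finF by simp
  also have "\<dots> \<le> (\<Sum>t\<in>Tr. (Q - 3) choose (n - 3))"
  proof (rule sum_mono)
    fix t assume "t \<in> Tr"
    then obtain A B C where t: "t = (A, B, C)" and "A < B" "B < C" "C < Q" by (auto simp: Tr_def)
    then have "card {A, B, C} = 3" "{A, B, C} \<subseteq> {..<Q}" by auto
    then show "card (F t) \<le> (Q - 3) choose (n - 3)"
      using card_supersets_le[of "{..<Q}" "{A, B, C}" n] by (simp add: F_def t)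
  qed
  also have "\<dots> = card Tr * ((Q - 3) choose (n - 3))" by simp
  also have "\<dots> \<le> 12 * K ^ 4 * (2 * a + K) * ((Q - 3) choose (n - 3))"
    unfolding Tr_def Q_def by (intro mult_right_mono card_flat_index_triples_le) simp
  finally show ?thesis by (simp add: a_def Q_def)
qed

lemma triangle_code_exists:
  assumes S: "S \<subseteq> {..<K * K}" "card S = n" and ABC: "A \<in> S" "B \<in> S" "C \<in> S" "A < B" "B < C"
  obtains m where "triangle_code n K m" "code_area K m = double_area K A B C"
    "\<And>q. q < K * K \<Longrightarrow> bit_at m q = 1 \<longleftrightarrow> q \<in> S"
proof -
  define Q where "Q = K * K"
  define a where "a = double_area K A B C"
  \<comment> \<open>Bit \<open>q\<close> of \<open>N\<close> records whether \<open>q\<close>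
    belongs to \<open>S\<close>.\<close>
  define N :: nat where "N = horner_sum of_bool 2 (map (\<lambda>q. q \<in> S) [0..<Q])"
  define w where "w = A + Q * (B + Q * (C + Q * a))"
  define m where "m = N + 2 ^ Q * w"
  have lt: "A < Q" "B < Q" "C < Q" using S ABC by (auto simp: Q_def)
  have N: "N < 2 ^ Q" using horner_sum_of_bool_2_less[of "map (\<lambda>q. q \<in> S) [0..<Q]"]
    by (simp add: N_def)
  then have "m div 2 ^ Q = w" "m mod 2 ^ Q = N" by (simp_all add: m_def)
  have "bit m q \<longleftrightarrow> q \<in> S" if "q < Q" for q
  proof -
    have "bit m q \<longleftrightarrow> bit (take_bit Q m) q" using that by (simp add: bit_take_bit_iff)
    also have "take_bit Q m = N" using \<open>m mod 2 ^ Q = N\<close> by (simp add: take_bit_eq_mod)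
    finally show ?thesis using that by (simp add: N_def bit_horner_sum_bit_iff)
  qed
  then have bit: "bit_at m q = 1 \<longleftrightarrow> q \<in> S" if "q < Q" for q
    using that unfolding bit_at_eq_1_iff by blast
  have v: "code_vertex K 0 m = A" "code_vertex K 1 m = B" "code_vertex K 2 m = C" "code_area K m = a"
    using \<open>m div 2 ^ Q = w\<close> lt
    by (simp_all add: code_vertex_def code_area_def w_def power2_eq_square power3_eq_cube div_mult2_eq
        flip: Q_def)
  have "{q. q < Q \<and> bit m q} = S"
    using bit S(1) unfolding bit_at_eq_1_iff by (auto simp: Q_def)
  then have "(\<Sum>q<Q. bit_at m q) = n" using S(2) by (simp add: sum_bit_at)
  then have "triangle_code n K m"
    using v bit lt ABC by (simp add: triangle_code_def a_def flip: Q_def)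
  then show ?thesis using that v(4) bit by (simp add: a_def Q_def)
qed

section \<open>Complexity and area\<close>

definition grid_pt :: "nat \<Rightarrow> nat \<Rightarrow> real ^ 2" where
  "grid_pt K q = grid_point K (q div K) (q mod K)"

lemma grid_point_component:
  "grid_point K i j $ 1 = real i / (real K - 1)" "grid_point K i j $ 2 = real j / (real K - 1)"
  by (simp_all add: grid_point_def)

lemma inj_grid_pt:
  assumes "K \<ge> 2"
  shows "inj (grid_pt K)"
proof (rule injI)
  fix p q assume eq: "grid_pt K p = grid_pt K q"
  have "real K - 1 \<noteq> 0" using assms by simp
  then have "p div K = q div K" "p mod K = q mod K"
    using arg_cong[OF eq, of "\<lambda>v. v $ 1"] arg_cong[OF eq, of "\<lambda>v. v $ 2"]
    by (simp_all add: grid_pt_def grid_point_component)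
  then show "p = q" by (metis div_mult_mod_eq)
qed

lemma grid_eq_image: "grid K = grid_pt K ` {..<K * K}"
proof (intro equalityI subsetI)
  fix v assume "v \<in> grid K"
  then obtain i j where ij: "v = grid_point K i j" "i < K" "j < K" by (auto simp: grid_def)
  then have "(i * K + j) div K = i" "(i * K + j) mod K = j" by auto
  then have "v = grid_pt K (i * K + j)" using ij by (simp add: grid_pt_def)
  moreover have "i * K + j < K * K"
  proof -
    have "i * K + j < Suc i * K" using ij by simp
    also have "\<dots> \<le> K * K" using ij by (intro mult_right_mono) auto
    finally show ?thesis .
  qed
  ultimately show "v \<in> grid_pt K ` {..<K * K}" by blast
next
  fix v assume "v \<in> grid_pt K ` {..<K * K}"
  then obtain q where q: "v = grid_pt K q" "q < K * K" by auto
  then have "q mod K < K" by (cases K) auto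
  with q less_mult_imp_div_less[of q K K] show "v \<in> grid K"
    unfolding grid_def grid_pt_def by blast
qed

lemma content_grid_triangle:
  assumes "K \<ge> 2"
  shows "measure lborel (convex hull {grid_pt K A, grid_pt K B, grid_pt K C}) =
    real (double_area K A B C) / (2 * (real K - 1)\<^sup>2)"
proof -
  have "real (double_area K A B C) = \<bar>real_of_int (cross (grid_pos K A) (grid_pos K B) (grid_pos K C))\<bar>"
    by (simp add: double_area_def)
  \<comment> \<open>The determinant in \<open>content_triangle\<close> has the orientation opposite
    to \<open>cross\<close>, hence the minus sign.\<close>
  moreover have "(grid_pt K C $ 1 - grid_pt K A $ 1) * (grid_pt K B $ 2 - grid_pt K A $ 2) -
      (grid_pt K B $ 1 - grid_pt K A $ 1) * (grid_pt K C $ 2 - grid_pt K A $ 2) =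
      - real_of_int (cross (grid_pos K A) (grid_pos K B) (grid_pos K C)) / (real K - 1)\<^sup>2"
    unfolding cross_def grid_pos_def grid_pt_def grid_point_component fst_conv snd_conv
      power2_eq_square times_divide_times_eq diff_divide_distrib[symmetric]
    by (rule arg_cong[where f = "\<lambda>t. t / ((real K - 1) * (real K - 1))"]) (simp add: algebra_simps)
  ultimately show ?thesis
    unfolding content_triangle by (simp add: abs_divide)
qed

lemma kolmogorov_le: "tm_outputs U p y x \<Longrightarrow> kolmogorov U x y \<le> length p"
  unfolding kolmogorov_def by (intro cInf_lower) auto

text \<open>Codes list their vertices in increasing order, whereas the pebbles of a triangle come in
  any order.\<close>

lemma sort_three:
  fixes a b c :: "'a::linorder"
  assumes "a \<noteq> b" "a \<noteq> c" "b \<noteq> c"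
  obtains a' b' c' where "a' < b'" "b' < c'" "{a', b', c'} = {a, b, c}"
proof -
  consider "a < b" "b < c" | "a < c" "c < b" | "b < a" "a < c" | "b < c" "c < a" | "c < a" "a < b" | "c < b" "b < a"
    using assms by (meson linorder_less_linear)
  then show ?thesis by cases (use that in blast)+
qed

text \<open>Here \<open>d\<close> is the double area in grid units, and the factor after
  \<open>2 ^ c\<close> bounds the position of the code in the search. The constant \<open>c\<close>
  depends on \<open>U\<close> alone, as the searched predicate contains no area threshold.\<close>

lemma complexity_of_flat_arrangement:
  assumes "universal_tm U"
  obtains c where "\<And>n K X A B C. \<lbrakk>K \<ge> 2; arrangement n K X; A \<in> X; B \<in> X; C \<in> X; A \<noteq> B; A \<noteq> C; B \<noteq> C\<rbrakk>
    \<Longrightarrow> \<exists>d. measure lborel (convex hull {A, B, C}) = real d / (2 * (real K - 1)\<^sup>2) \<and>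
      2 ^ kolmogorov U (encode_arrangement K X) (encode_pair n K)
        \<le> 2 ^ c * (12 * K ^ 4 * (2 * d + K) * ((K * K - 3) choose (n - 3)))"
proof -
  obtain T where T: "turing_machine T"
    "\<And>n K m. triangle_code n K m \<Longrightarrow> \<exists>p. 2 ^ length p \<le> card {k. k \<le> m \<and> triangle_code n K k} \<and>
       tm_outputs T p (encode_pair n K) (map (\<lambda>q. bit_at m q = 1) [0..<K * K])"
    using search_machine[OF computable_triangle_code] by blast
  obtain c where c: "\<And>p. \<exists>q. length q \<le> length p + c \<and> (\<forall>y x. tm_outputs U q y x \<longleftrightarrow> tm_outputs T p y x)"
    using assms T(1) unfolding universal_tm_def by blast
  have "\<exists>d. measure lborel (convex hull {A, B, C}) = real d / (2 * (real K - 1)\<^sup>2) \<and>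
      2 ^ kolmogorov U (encode_arrangement K X) (encode_pair n K)
        \<le> 2 ^ c * (12 * K ^ 4 * (2 * d + K) * ((K * K - 3) choose (n - 3)))"
    if K: "K \<ge> 2" and X: "arrangement n K X" and ABC: "A \<in> X" "B \<in> X" "C \<in> X" "A \<noteq> B" "A \<noteq> C" "B \<noteq> C"
    for n K X A B C
  proof -
    define S where "S = {q. q < K * K \<and> grid_pt K q \<in> X}"
    have im: "grid_pt K ` S = X"
      using X unfolding arrangement_def grid_eq_image S_def by auto
    have "card S = n"
      using X im card_image[OF inj_on_subset[OF inj_grid_pt[OF K] subset_UNIV], of S]
      by (simp add: arrangement_def)
    obtain p q r where pqr: "p \<in> S" "q \<in> S" "r \<in> S" "A = grid_pt K p" "B = grid_pt K q" "C = grid_pt K r"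
      using ABC im by (metis imageE)
    then have "p \<noteq> q" "p \<noteq> r" "q \<noteq> r" using ABC by auto
    then obtain p' q' r' where lt: "p' < q'" "q' < r'" and eq: "{p', q', r'} = {p, q, r}"
      by (rule sort_three)
    have "{A, B, C} = grid_pt K ` {p', q', r'}" unfolding eq pqr by simp
    then have ABC': "{A, B, C} = {grid_pt K p', grid_pt K q', grid_pt K r'}" by simp
    have "{p', q', r'} \<subseteq> S" unfolding eq using pqr by blast
    then have S': "p' \<in> S" "q' \<in> S" "r' \<in> S" by auto
    obtain m where m: "triangle_code n K m" "code_area K m = double_area K p' q' r'"
      "\<And>i. i < K * K \<Longrightarrow> bit_at m i = 1 \<longleftrightarrow> i \<in> S"
      by (rule triangle_code_exists[OF _ \<open>card S = n\<close> S' lt]) (auto simp: S_def)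
    have "map (\<lambda>i. bit_at m i = 1) [0..<K * K] = encode_arrangement K X"
      unfolding encode_arrangement_def
    proof (rule map_cong[OF refl])
      fix i assume "i \<in> set [0..<K * K]"
      then have "i < K * K" by simp
      with m(3)[OF this] show "(bit_at m i = 1) = (grid_point K (i div K) (i mod K) \<in> X)"
        by (simp add: S_def grid_pt_def)
    qed
    with T(2)[OF m(1)] obtain w where w: "2 ^ length w \<le> card {k. k \<le> m \<and> triangle_code n K k}"
      "tm_outputs T w (encode_pair n K) (encode_arrangement K X)" by auto
    obtain w' where w': "length w' \<le> length w + c" "tm_outputs U w' (encode_pair n K) (encode_arrangement K X)"
      using c[of w] w(2) by blast
    have "kolmogorov U (encode_arrangement K X) (encode_pair n K) \<le> length w + c"
      using kolmogorov_le[OF w'(2)] w'(1) by simp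
    then have "2 ^ kolmogorov U (encode_arrangement K X) (encode_pair n K) \<le> (2::nat) ^ (length w + c)"
      by (rule power_increasing) simp
    also have "\<dots> = 2 ^ c * 2 ^ length w" by (simp add: power_add)
    also have "\<dots> \<le> 2 ^ c * (12 * K ^ 4 * (2 * double_area K p' q' r' + K) * ((K * K - 3) choose (n - 3)))"
      using order.trans[OF w(1) card_triangle_codes_le] m(2) by simp
    finally show ?thesis
      using content_grid_triangle[OF K, of p' q' r'] unfolding ABC' by blast
  qed
  then show ?thesis using that by blast
qed

text \<open>Three absorption steps give \<open>n (n-1) (n-2) (Q choose n) = Q (Q-1) (Q-2) ((Q-3)
  choose (n-3))\<close>. The first product is at most \<open>n ^ 3\<close>, and
  \<open>Q ^ 2 \<le> 4 (Q-1) (Q-2)\<close> from \<open>Q = 4\<close> on.\<close>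

lemma binomial_minus3_le:
  assumes "3 \<le> n" "4 \<le> Q"
  shows "real ((Q - 3) choose (n - 3)) * real Q ^ 3 \<le> 4 * real n ^ 3 * real (Q choose n)"
proof -
  define k where "k = n - 3"
  define l where "l = Q - 3"
  have n: "n = Suc (Suc (Suc k))" using assms(1) by (simp add: k_def)
  have Q: "Q = Suc (Suc (Suc l))" "l \<ge> 1" using assms(2) by (simp_all add: l_def)
  have step: "real (Suc k) * real (Suc l choose Suc k) = real (Suc l) * real (l choose k)" for k l
    using Suc_times_binomial[of k l] by (metis of_nat_mult)
  have telescope: "z\<^sub>3 * z\<^sub>2 * z\<^sub>1 * b = y\<^sub>3 * y\<^sub>2 * y\<^sub>1 * b\<^sub>3"
    if "y\<^sub>1 * b\<^sub>1 = z\<^sub>1 * b" "y\<^sub>2 * b\<^sub>2 = z\<^sub>2 * b\<^sub>1" "y\<^sub>3 * b\<^sub>3 = z\<^sub>3 * b\<^sub>2"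
    for z\<^sub>1 z\<^sub>2 z\<^sub>3 y\<^sub>1 y\<^sub>2 y\<^sub>3 b b\<^sub>1 b\<^sub>2 b\<^sub>3 :: real
    using that by algebra
  have "real Q * real (Suc (Suc l)) * real (Suc l) * real (l choose k) =
      real n * real (Suc (Suc k)) * real (Suc k) * real (Q choose n)"
    using step[of k l] step[of "Suc k" "Suc l"] step[of "Suc (Suc k)" "Suc (Suc l)"]
    unfolding n Q by (rule telescope)
  also have "\<dots> \<le> real n * real n * real n * real (Q choose n)"
    unfolding n by (intro mult_right_mono mult_mono) auto
  finally have 1: "real Q * real (Suc (Suc l)) * real (Suc l) * real (l choose k)
      \<le> real n ^ 3 * real (Q choose n)" by (simp add: power3_eq_cube)
  have "real Q * real Q \<le> 4 * (real (Suc (Suc l)) * real (Suc l))"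
  proof -
    have "1 \<le> real l" "0 \<le> real l * real l" using Q(2) by auto
    moreover have "4 * (real (Suc (Suc l)) * real (Suc l)) - real Q * real Q = 3 * (real l * real l) + 6 * real l - 1"
      unfolding Q(1) by (simp add: algebra_simps)
    ultimately show ?thesis by linarith
  qed
  then have "real Q * (real Q * real Q) * real (l choose k)
      \<le> real Q * (4 * (real (Suc (Suc l)) * real (Suc l))) * real (l choose k)"
    by (intro mult_right_mono mult_left_mono) auto
  also have "\<dots> = 4 * (real Q * real (Suc (Suc l)) * real (Suc l) * real (l choose k))"
    by (simp only: mult_ac)
  also have "\<dots> \<le> 4 * (real n ^ 3 * real (Q choose n))" using 1 by (rule mult_left_mono) simp
  finally show ?thesis by (simp only: k_def l_def power3_eq_cube mult_ac)
qed

text \<open>If the area were smaller, the inequality labelled \<open>2\<close> would bound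
  \<open>K ^ 2\<close> by two summands. The constants 384 and 96 make the one with \<open>d\<close>
  less than half of \<open>K ^ 2\<close> and the one with \<open>K\<close> at most half.\<close>

lemma flat_index_bound:
  fixes n K c \<delta> d k :: nat
  assumes n: "3 \<le> n" and K: "2 \<le> K" "n \<le> K" and large: "96 * 2 ^ (c + \<delta>) * real n ^ 3 \<le> real K"
    and k: "real (2 ^ k) \<le> 2 ^ c * (12 * real K ^ 4 * (2 * real d + real K) * real ((K * K - 3) choose (n - 3)))"
    and log: "log 2 (real (K\<^sup>2 choose n)) - real \<delta> \<le> real k"
  shows "1 / (384 * 2 ^ c) / (2 ^ \<delta> * real n ^ 3) \<le> real d / (2 * (real K - 1)\<^sup>2)"
proof (rule ccontr)
  assume neg: "\<not> ?thesis"
  define N where "N = real (K\<^sup>2 choose n)"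
  define B where "B = real ((K * K - 3) choose (n - 3))"
  \<comment> \<open>Makes the binomial coefficient positive, so that the logarithm can be
    exponentiated.\<close>
  have "n \<le> K\<^sup>2" using K(2) le_square[of K] unfolding power2_eq_square by (rule order.trans)
  then have N: "N > 0" by (simp add: N_def)
  have K0: "real K > 0" using K by simp
  have n0: "real n > 0" using n by simp
  have "log 2 N \<le> real (k + \<delta>)" using log by (simp add: N_def)
  then have "N \<le> 2 powr real (k + \<delta>)" using N by (simp add: log_le_iff)
  then have "N \<le> 2 ^ \<delta> * 2 ^ k" 
    using powr_realpow[of 2 "k + \<delta>"] by (simp add: power_add mult.commute del: of_nat_add)
  also have "\<dots> \<le> 2 ^ \<delta> * (2 ^ c * (12 * real K ^ 4 * (2 * real d + real K) * B))"
    using k by (simp add: B_def)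
  finally have 1: "N \<le> 12 * 2 ^ (c + \<delta>) * real K ^ 4 * (2 * real d + real K) * B"
    by (simp add: power_add mult_ac)
  have "4 \<le> K * K" using mult_mono[OF K(1) K(1)] by simp
  then have B: "B * real K ^ 6 \<le> 4 * real n ^ 3 * N"
    using binomial_minus3_le[OF n, of "K * K"] by (simp add: B_def N_def power2_eq_square power_mult_distrib flip: power_add)
  have "N * real K ^ 6 \<le> 12 * 2 ^ (c + \<delta>) * real K ^ 4 * (2 * real d + real K) * B * real K ^ 6"
    using 1 by (intro mult_right_mono) auto
  also have "\<dots> = 12 * 2 ^ (c + \<delta>) * real K ^ 4 * (2 * real d + real K) * (B * real K ^ 6)" by simp
  also have "\<dots> \<le> 12 * 2 ^ (c + \<delta>) * real K ^ 4 * (2 * real d + real K) * (4 * real n ^ 3 * N)"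
    using B by (intro mult_left_mono) auto
  finally have "(N * real K ^ 4) * real K ^ 2 \<le>
      (N * real K ^ 4) * (48 * 2 ^ (c + \<delta>) * real n ^ 3 * (2 * real d + real K))"
    by (simp add: mult_ac flip: power_add)
  \<comment> \<open>The 48 is 12 from the count of flat triples times 4 from
    \<open>binomial_minus3_le\<close>.\<close>
  then have 2: "real K ^ 2 \<le> 48 * 2 ^ (c + \<delta>) * real n ^ 3 * (2 * real d + real K)"
    using N K0 by (simp add: mult_le_cancel_left)
  have K1: "(real K - 1)\<^sup>2 > 0" using K by simp
  have "real d < 1 / (384 * 2 ^ c) / (2 ^ \<delta> * real n ^ 3) * (2 * (real K - 1)\<^sup>2)"
    using neg K1 by (simp add: not_le pos_divide_less_eq)
  also have "\<dots> \<le> 1 / (384 * 2 ^ c) / (2 ^ \<delta> * real n ^ 3) * (2 * real K ^ 2)"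
    using K by (intro mult_left_mono power_mono) auto
  finally have "192 * 2 ^ (c + \<delta>) * real n ^ 3 * real d < real K ^ 2"
    using n0 by (simp add: field_simps power_add)
  moreover have "96 * 2 ^ (c + \<delta>) * real n ^ 3 * real K \<le> real K * real K"
    using large K0 by (intro mult_right_mono) auto
  ultimately show False using 2 by (simp add: algebra_simps power2_eq_square)
qed

theorem theorem1:
  fixes U :: tm
  assumes "universal_tm U"
  shows "\<exists>c\<^sub>1::real. c\<^sub>1 > 0 \<and>
    (\<forall>\<delta>::nat. \<delta> > 0 \<longrightarrow>
      (\<forall>\<^sub>F n in sequentially. \<forall>\<^sub>F K in sequentially.
        \<forall>X. arrangement n K X \<and>
            real (kolmogorov U (encode_arrangement K X) (encode_pair n K))
              \<ge> log 2 (real (K\<^sup>2 choose n)) - real \<delta> \<longrightarrow>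
          (\<forall>A\<in>X. \<forall>B\<in>X. \<forall>C\<in>X. A \<noteq> B \<and> A \<noteq> C \<and> B \<noteq> C \<longrightarrow>
            measure lborel (convex hull {A, B, C}) \<ge> c\<^sub>1 / (2 ^ \<delta> * real n ^ 3))))"
proof -
  obtain c where c: "\<And>n K X A B C. \<lbrakk>K \<ge> 2; arrangement n K X; A \<in> X; B \<in> X; C \<in> X; A \<noteq> B; A \<noteq> C; B \<noteq> C\<rbrakk>
    \<Longrightarrow> \<exists>d. measure lborel (convex hull {A, B, C}) = real d / (2 * (real K - 1)\<^sup>2) \<and>
      2 ^ kolmogorov U (encode_arrangement K X) (encode_pair n K)
        \<le> 2 ^ c * (12 * K ^ 4 * (2 * d + K) * ((K * K - 3) choose (n - 3)))"
    using complexity_of_flat_arrangement[OF assms] by blast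
  have main: "1 / (384 * 2 ^ c) / (2 ^ \<delta> * real n ^ 3) \<le> measure lborel (convex hull {A, B, C})"
    if n: "3 \<le> n" and K: "2 \<le> K" "n \<le> K" "96 * 2 ^ (c + \<delta>) * real n ^ 3 \<le> real K"
      and X: "arrangement n K X"
      and log: "log 2 (real (K\<^sup>2 choose n)) - real \<delta> \<le> real (kolmogorov U (encode_arrangement K X) (encode_pair n K))"
      and ABC: "A \<in> X" "B \<in> X" "C \<in> X" "A \<noteq> B" "A \<noteq> C" "B \<noteq> C" for n K \<delta> X A B C
  proof -
    let ?k = "kolmogorov U (encode_arrangement K X) (encode_pair n K)"
    obtain d where d: "measure lborel (convex hull {A, B, C}) = real d / (2 * (real K - 1)\<^sup>2)"
      "2 ^ ?k \<le> 2 ^ c * (12 * K ^ 4 * (2 * d + K) * ((K * K - 3) choose (n - 3)))"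
      using c[OF K(1) X ABC] by blast
    from d(2) have "real (2 ^ ?k) \<le> real (2 ^ c * (12 * K ^ 4 * (2 * d + K) * ((K * K - 3) choose (n - 3))))"
      by (rule of_nat_mono)
    then have "real (2 ^ ?k) \<le> 2 ^ c * (12 * real K ^ 4 * (2 * real d + real K) * real ((K * K - 3) choose (n - 3)))"
      by simp
    from flat_index_bound[OF n K this log] show ?thesis by (simp only: d(1))
  qed
  show ?thesis
  \<comment> \<open>The exponent \<open>c\<close> was obtained before \<open>\<delta>\<close>,
    \<open>n\<close> and \<open>K\<close> are fixed, so this constant depends on \<open>U\<close>
    only.\<close>
  proof (intro exI[of _ "1 / (384 * 2 ^ c)"] conjI allI impI)
    fix \<delta> :: nat
    show "\<forall>\<^sub>F n in sequentially. \<forall>\<^sub>F K in sequentially.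
        \<forall>X. arrangement n K X \<and>
            real (kolmogorov U (encode_arrangement K X) (encode_pair n K))
              \<ge> log 2 (real (K\<^sup>2 choose n)) - real \<delta> \<longrightarrow>
          (\<forall>A\<in>X. \<forall>B\<in>X. \<forall>C\<in>X. A \<noteq> B \<and> A \<noteq> C \<and> B \<noteq> C \<longrightarrow>
            measure lborel (convex hull {A, B, C}) \<ge> 1 / (384 * 2 ^ c) / (2 ^ \<delta> * real n ^ 3))"
      \<comment> \<open>From 3 on, the subtraction in \<open>n - 3\<close> is not truncated.\<close>
      using eventually_ge_at_top[of 3]
    proof eventually_elim
      case (elim n)
      have "\<forall>\<^sub>F K in sequentially. 96 * 2 ^ (c + \<delta>) * real n ^ 3 \<le> real K"
        using filterlim_real_sequentially by (simp add: filterlim_at_top)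
      then show ?case
        using eventually_ge_at_top[of 2] eventually_ge_at_top[of n]
        by eventually_elim (use main[OF elim] in blast)
    qed
  qed simp
qed

end
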